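(* Let $X$ be a non-negative random variable with distribution $F_X$ such that $\psi_{F_X}(\lambda)=\mathbb{E}[\log(1+\lambda X)]<\infty$ for all $\lambda>0$. For $c>0$ let $A_c\overset{d}{=}cX/(cX+1)$. Let $0<\sigma\le1$, let $Y_\sigma$ be a Bernoulli random variable with success probability $\sigma$, independent of $X$ and of $A_c$, and assume that $F_{XY_\sigma}$ has no jump of size one. Then the random variables $M_1(F_{XY_\sigma})\overset{d}{=}\beta_{\sigma,1-\sigma}M_\sigma(F_X)$ and $M_1(F_{A_cY_\sigma})\overset{d}{=}\beta_{\sigma,1-\sigma}M_\sigma(F_{A_c})$ satisfy the following. (i) The density of $M_1(F_{A_cY_\sigma})$ is $$\xi_{F_{A_cY_\sigma}}(y)=\frac{e^{\sigma\psi_{F_X}(c)}\,y^{\sigma-1}}{\pi\,c^\sigma(1-y)^\sigma}\,\sin\!\left[\pi F_{XY_\sigma}\!\left(\frac{y}{c(1-y)}\right)\right]e^{-\sigma\Phi_{F_X}\left(\frac{y}{c(1-y)}\right)},\qquad 0<y<1.$$ (ii) Conversely, the density of $M_1(F_{XY_\sigma})$ is $$\xi_{F_{XY_\sigma}}(x)=\frac{e^{-\sigma\psi_{F_X}(1)}\,x^{\sigma-1}}{\pi(1+x)^{\sigma}}\,\sin\!\left[\pi F_{A_1Y_\sigma}\!\left(\frac{x}{1+x}\right)\right]e^{-\sigma\Phi_{F_{A_1}}\left(\frac{x}{1+x}\right)},\qquad x>0.$$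
   Context: $F_R$ denotes both the distribution and the cdf of a random variable $R$. For a non-negative random variable $R$, $\Phi_{F_R}(t)=\mathbb{E}[\log(|t-R|)\,\mathbb{I}(t\ne R)]$ and $F_{RY_\sigma}(x)=\sigma F_R(x)+(1-\sigma)\mathbb{I}(x\ge0)$. Dirichlet process and Dirichlet mean: for $\theta>0$ and a probability distribution $F$ on $[0,\infty)$, a Dirichlet process $P_\theta$ with total mass $\theta$ and parameter $F$ is a random probability measure on $[0,\infty)$ such that for every finite measurable partition $(C_1,\dots,C_k)$ of $[0,\infty)$ the vector $(P_\theta(C_1),\dots,P_\theta(C_k))$ is Dirichlet distributed with parameters $(\theta F(C_1),\dots,\theta F(C_k))$. The Dirichlet mean is $M_\theta(F)\overset{d}{=}\int_0^\infty x\,P_\theta(dx)$. $\beta_{a,b}$ denotes a beta$(a,b)$ random variable, with $\beta_{1,0}:=1$. In products the factors are independent. Densities are with respect to Lebesgue measure, up to null sets. *)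

theory Defs
  imports "HOL-Probability.Probability"
begin

abbreviation law :: "'a measure \<Rightarrow> ('a \<Rightarrow> real) \<Rightarrow> real measure" where
  "law M R \<equiv> distr M borel R"

definition psi :: "real measure \<Rightarrow> real \<Rightarrow> real" where
  "psi F l = (\<integral>x. ln (1 + l * x) \<partial>F)"

text \<open>If \<open>F\<close> integrates \<open>ln (1 + x)\<close>, the integrand below can fail to be integrable only for
  \<open>t\<close> in a Lebesgue null set (where the expectation is minus infinity); the Bochner integral is 0
  there, which does not matter inside a density.\<close>

definition Phi :: "real measure \<Rightarrow> real \<Rightarrow> real" where
  "Phi F t = (\<integral>x. ln \<bar>t - x\<bar> * indicator {x. t \<noteq> x} x \<partial>F)"

text \<open>The gamma distribution with shape \<open>a\<close> and scale 1. Shape 0 is the point mass at 0, so that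
  Dirichlet vectors may have zero parameters.\<close>

definition gamma_distr :: "real \<Rightarrow> real measure" where
  "gamma_distr a =
    (if 0 < a
     then density lborel (\<lambda>x. ennreal (if 0 < x then x powr (a - 1) * exp (- x) / Gamma a else 0))
     else return borel 0)"

text \<open>The Dirichlet distribution with parameters \<open>\<alpha> 0, \<dots>, \<alpha> (k - 1)\<close>, non-negative and not all
  zero: the law of a vector of independent gamma variables divided by its sum (Ferguson's
  definition). Components with parameter 0 are almost surely 0.\<close>

definition dirichlet_distr :: "nat \<Rightarrow> (nat \<Rightarrow> real) \<Rightarrow> (nat \<Rightarrow> real) measure" where
  "dirichlet_distr k \<alpha> =
    distr (\<Pi>\<^sub>M i\<in>{..<k}. gamma_distr (\<alpha> i)) (\<Pi>\<^sub>M i\<in>{..<k}. borel)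
      (\<lambda>g. \<lambda>i\<in>{..<k}. g i / (\<Sum>j<k. g j))"

text \<open>\<open>P\<close> is a random probability measure on the half-line, defined on the probability space
  \<open>\<Omega>\<close>. The parameter \<open>F\<close> is given as a measure on the Borel sets of the whole line, of which only
  the values on Borel subsets of the half-line are used.\<close>

definition dirichlet_process ::
    "'w measure \<Rightarrow> real \<Rightarrow> real measure \<Rightarrow> ('w \<Rightarrow> real measure) \<Rightarrow> bool" where
  "dirichlet_process \<Omega> \<theta> F P \<longleftrightarrow>
    prob_space \<Omega> \<and>
    P \<in> \<Omega> \<rightarrow>\<^sub>M prob_algebra (restrict_space borel {0..}) \<and>
    (\<forall>(k::nat) (C::nat \<Rightarrow> real set).
      (\<forall>i<k. C i \<in> sets borel) \<and> disjoint_family_on C {..<k} \<and> (\<Union>i<k. C i) = {0..} \<longrightarrow>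
      distr \<Omega> (\<Pi>\<^sub>M i\<in>{..<k}. borel) (\<lambda>\<omega>. \<lambda>i\<in>{..<k}. measure (P \<omega>) (C i))
        = dirichlet_distr k (\<lambda>i. \<theta> * measure F (C i)))"

text \<open>The value is 0 where the integral diverges. A mean whose law has a Lebesgue density has no
  atom at 0, so for such a mean the integral converges almost surely.\<close>

definition dirichlet_mean :: "('w \<Rightarrow> real measure) \<Rightarrow> 'w \<Rightarrow> real" where
  "dirichlet_mean P \<omega> = (\<integral>x. x \<partial>(P \<omega>))"

definition beta_distr :: "real \<Rightarrow> real \<Rightarrow> real measure" where
  "beta_distr a b =
    (if a = 1 \<and> b = 0 then return borel 1
     else density lborel (\<lambda>x. ennreal
       (if 0 < x \<and> x < 1 then x powr (a - 1) * (1 - x) powr (b - 1) / Beta a b else 0)))"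

end

theory Submission
  imports Defs "HOL-Complex_Analysis.Conformal_Mappings"
begin

text \<open>All four claims follow from one identity for Dirichlet means and from its inversion.

  The identity is that of Markov and Krein: the mean \<open>D\<close> of a Dirichlet process with total mass
  \<open>\<theta>\<close> and parameter \<open>F\<close> satisfies \<open>E ((1 + z * D) powr - \<theta>) = exp (- \<theta> * psi F z)\<close> for
  \<open>z > 0\<close> (\<open>dirichlet_process_mean_transform\<close>). Replace the identity function, whose
  integral is \<open>D\<close>, by a simple function. Then only the random masses of finitely many sets matter, and
  these are ratios \<open>g i / S\<close> of independent gamma variables to their sum. The sum is
  gamma distributed with shape \<open>\<theta>\<close> and independent of the ratios, so the left-hand side is the
  expectation of \<open>exp (- S * z * D)\<close>; but \<open>S * D\<close> is a linear combination of the \<open>g i\<close>, and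
  this expectation is a product of gamma Laplace transforms. The general case is a monotone limit.

  For \<open>\<theta> = 1\<close> the identity says that the Stieltjes transform of the law of \<open>D\<close> is the exponential
  of minus a logarithmic transform of \<open>F\<close>. It extends to the complex plane slit along the negative
  half-line (\<open>stieltjes_identity_slit_plane\<close>), and the density of \<open>D\<close> is read off from the
  imaginary part near the slit: its limit at \<open>- x\<close> is
  \<open>- sin (pi * cdf F x) * exp (- Phi F x)\<close>. What needs an argument is that no singular part is lost in the
  limit, and this is where the absence of a unit jump enters. Every point has a neighbourhood of
  \<open>F\<close>-mass \<open>q < 1\<close>, and by Jensen's inequality the transform is dominated there, uniformly
  in the distance to the slit, by the locally integrable Riesz potential of \<open>\<bar>x - t\<bar> powr - q\<close>
  (\<open>exp_log_potential_bound\<close>). So dominated convergence identifies the law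
  (\<open>\<mu>_eq_density\<close>), and the same theorem shows that the transform determines the law.

  The identities in law follow because a beta variable \<open>B\<close> with parameters \<open>\<sigma>\<close> and \<open>1 - \<sigma>\<close> satisfies
  \<open>E (1 / (1 + w * B)) = (1 + w) powr - \<sigma>\<close>. Hence \<open>B\<close> times the mean with parameter
  \<open>F\<^sub>X\<close> and total mass \<open>\<sigma>\<close> has the Stieltjes transform \<open>exp (- \<sigma> * psi F\<^sub>X z)\<close>, the same as the mean with
  total mass 1 and parameter \<open>F\<^sub>X\<^sub>Y\<close>, because the atom of \<open>F\<^sub>X\<^sub>Y\<close> at 0 does not contribute to
  \<open>psi\<close>.

  The formulas for the densities are the general one, rewritten. The atom at 0 produces the factor
  \<open>x powr (\<sigma> - 1)\<close>, and the map from \<open>x\<close> to \<open>c * x / (c * x + 1)\<close> is fractional linear, so that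
  it changes the logarithmic potential by explicit terms (\<open>Phi_squash\<close>) and preserves the
  distribution function.\<close>

section \<open>Gamma products and the Dirichlet distribution\<close>
lemma prob_space_gamma_distr: "prob_space (gamma_distr a)"
proof (cases "0 < a")
  case True
  have "(\<integral>\<^sup>+x. ennreal (if 0 < x then x powr (a - 1) * exp (- x) / Gamma a else 0) \<partial>lborel)
      = (\<integral>\<^sup>+x. ennreal (x powr (a - 1) / exp x / Gamma a) * indicator {0..} x \<partial>lborel)"
    by (intro nn_integral_cong) (auto simp: indicator_def exp_minus field_simps)
  also have "\<dots> = ennreal (Gamma a / Gamma a)"
    using Gamma_real_pos[OF True]
    by (intro nn_integral_has_integral_lebesgue' has_integral_divide Gamma_integral_real True) auto
  finally show ?thesis
    using True Gamma_real_pos[OF True]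
    by (auto simp: gamma_distr_def emeasure_density intro!: prob_spaceI)
qed (simp add: gamma_distr_def prob_space_return)

lemma sets_gamma_distr [simp, measurable_cong]: "sets (gamma_distr a) = sets borel"
  by (simp add: gamma_distr_def)

lemma space_gamma_distr [simp]: "space (gamma_distr a) = UNIV"
  by (simp add: gamma_distr_def)

lemma AE_gamma_distr_nonneg: "AE x in gamma_distr a. 0 \<le> x"
  unfolding gamma_distr_def by (auto simp: AE_density AE_return)

text \<open>Rescaling a gamma variable only tilts its law exponentially. The shape 0, where the law is the point
mass at 0, obeys the same formula.\<close>
lemma gamma_distr_scale:
  assumes a: "0 \<le> a" and p: "0 < p"
  shows "distr (gamma_distr a) borel (\<lambda>x. x / p)
       = density (gamma_distr a) (\<lambda>x. ennreal (p powr a * exp ((1 - p) * x)))"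
proof (cases "a = 0")
  case True
  then show ?thesis
    using p by (auto simp: gamma_distr_def distr_return emeasure_density nn_integral_return
        simp flip: indicator_def intro!: measure_eqI)
next
  case False
  with a have a: "0 < a" by simp
  define g where "g x = (if 0 < x then x powr (a - 1) * exp (- x) / Gamma a else 0)" for x :: real
  have [measurable]: "g \<in> borel_measurable borel" unfolding g_def by measurable
  have gd: "gamma_distr a = density lborel (\<lambda>x. ennreal (g x))"
    using a by (simp add: gamma_distr_def g_def)
  have g0: "0 \<le> g x" for x using Gamma_real_pos[OF a] by (simp add: g_def)
  have key: "p * g (p * y) = g y * (p powr a * exp ((1 - p) * y))" for y
    using p by (auto simp: g_def zero_less_mult_iff powr_mult powr_diff algebra_simps
        simp flip: exp_add)
  show ?thesis
  proof (rule measure_eqI)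
    fix A assume "A \<in> sets (distr (gamma_distr a) borel (\<lambda>x. x / p))"
    then have [measurable]: "A \<in> sets borel" by simp
    have "emeasure (distr (gamma_distr a) borel (\<lambda>x. x / p)) A
        = (\<integral>\<^sup>+x. indicator A x \<partial>distr (gamma_distr a) borel (\<lambda>x. x / p))"
      by simp
    also have "\<dots> = (\<integral>\<^sup>+x. ennreal (g x) * indicator A (x / p) \<partial>lborel)"
      unfolding gd by (subst nn_integral_distr) (auto simp: nn_integral_density)
    also have "\<dots> = ennreal p * (\<integral>\<^sup>+y. ennreal (g (p * y)) * indicator A y \<partial>lborel)"
      using p by (subst nn_integral_real_affine[where c=p and t=0]) auto
    also have "\<dots> = (\<integral>\<^sup>+y. ennreal (p * g (p * y)) * indicator A y \<partial>lborel)"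
      using p g0 by (subst nn_integral_cmult[symmetric]) (auto simp: ennreal_mult mult.assoc)
    also have "\<dots> = emeasure (density (gamma_distr a) (\<lambda>x. ennreal (p powr a * exp ((1 - p) * x)))) A"
      using g0 unfolding gd key
      by (simp add: emeasure_density nn_integral_density ennreal_mult mult.assoc)
    finally show "emeasure (distr (gamma_distr a) borel (\<lambda>x. x / p)) A = \<dots>" .
  qed simp
qed

text \<open>The tilted law of the previous lemma is again a probability law, which fixes the normalising factor.\<close>
lemma gamma_distr_exp_integral:
  assumes a: "0 \<le> a" and w: "0 \<le> w"
  shows "(\<integral>\<^sup>+x. ennreal (exp (- w * x)) \<partial>gamma_distr a) = ennreal ((1 + w) powr - a)"
proof -
  interpret prob_space "gamma_distr a" by (rule prob_space_gamma_distr)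
  \<comment> \<open>scaling by \<open>1 + w\<close> produces the tilt \<open>exp (- w * x)\<close>\<close>
  interpret D: prob_space "distr (gamma_distr a) borel (\<lambda>x. x / (1 + w))"
    by (rule prob_space_distr) simp
  have "1 = emeasure (distr (gamma_distr a) borel (\<lambda>x. x / (1 + w))) UNIV"
    using D.emeasure_space_1 by simp
  also have "\<dots> = (\<integral>\<^sup>+x. ennreal ((1 + w) powr a) * ennreal (exp (- w * x)) \<partial>gamma_distr a)"
    using w by (subst gamma_distr_scale[OF a]) (auto simp: emeasure_density ennreal_mult)
  also have "\<dots> = ennreal ((1 + w) powr a) * (\<integral>\<^sup>+x. ennreal (exp (- w * x)) \<partial>gamma_distr a)"
    by (rule nn_integral_cmult) simp
  finally have *: "1 = ennreal ((1 + w) powr a) * (\<integral>\<^sup>+x. ennreal (exp (- w * x)) \<partial>gamma_distr a)" .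
  have "ennreal ((1 + w) powr - a)
      = ennreal ((1 + w) powr - a) * (ennreal ((1 + w) powr a) * (\<integral>\<^sup>+x. ennreal (exp (- w * x)) \<partial>gamma_distr a))"
    by (subst *[symmetric]) simp
  also have "\<dots> = (\<integral>\<^sup>+x. ennreal (exp (- w * x)) \<partial>gamma_distr a)"
    using w by (simp flip: mult.assoc ennreal_mult powr_add)
  finally show ?thesis ..
qed

definition gamma_product :: "nat \<Rightarrow> (nat \<Rightarrow> real) \<Rightarrow> (nat \<Rightarrow> real) measure" where
  "gamma_product k \<alpha> = (\<Pi>\<^sub>M i\<in>{..<k}. gamma_distr (\<alpha> i))"

lemma sets_gamma_product [simp, measurable_cong]:
  "sets (gamma_product k \<alpha>) = sets (\<Pi>\<^sub>M i\<in>{..<k}. borel)"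
  unfolding gamma_product_def by (intro sets_PiM_cong) auto

lemma prob_space_gamma_product: "prob_space (gamma_product k \<alpha>)"
  unfolding gamma_product_def by (intro prob_space_PiM prob_space_gamma_distr)

text \<open>Both sides are product measures, and their factors agree by the one-dimensional scaling law. The
density depends on the vector only through its sum: this is what makes the sum of independent gamma
variables independent of their ratios.\<close>
lemma gamma_product_scale:
  assumes \<alpha>: "\<And>i. i < k \<Longrightarrow> 0 \<le> \<alpha> i" and p: "0 < p"
  shows "distr (gamma_product k \<alpha>) (\<Pi>\<^sub>M i\<in>{..<k}. borel) (\<lambda>g. \<lambda>i\<in>{..<k}. g i / p)
       = density (gamma_product k \<alpha>)
           (\<lambda>g. ennreal (p powr (\<Sum>i<k. \<alpha> i) * exp ((1 - p) * (\<Sum>i<k. g i))))"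
proof -
  define N where "N = (\<lambda>i. distr (gamma_distr (\<alpha> i)) borel (\<lambda>x. x / p))"
  interpret G: product_prob_space "\<lambda>i. gamma_distr (\<alpha> i)"
    by (simp add: product_prob_spaceI prob_space_gamma_distr)
  have "prob_space (N i)" for i
    unfolding N_def using prob_space_gamma_distr by (rule prob_space.prob_space_distr) simp
  then interpret N: product_prob_space N by (rule product_prob_spaceI)
  have sN: "sets (PiM {..<k} N) = sets (\<Pi>\<^sub>M i\<in>{..<k}. borel)"
    by (intro sets_PiM_cong) (auto simp: N_def)
  have sp: "space (gamma_product k \<alpha>) = PiE {..<k} (\<lambda>_. UNIV)"
    by (simp add: gamma_product_def space_PiM)
  have dens: "ennreal (p powr (\<Sum>i<k. \<alpha> i) * exp ((1 - p) * (\<Sum>i<k. g i)))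
      = (\<Prod>i<k. ennreal (p powr \<alpha> i * exp ((1 - p) * g i)))" for g
    using p by (simp add: prod_ennreal prod.distrib powr_sum sum_distrib_left exp_sum)
  have "distr (gamma_product k \<alpha>) (\<Pi>\<^sub>M i\<in>{..<k}. borel) (\<lambda>g. \<lambda>i\<in>{..<k}. g i / p) = PiM {..<k} N"
  proof (rule N.PiM_eqI)
    fix A assume A: "\<And>i. i \<in> {..<k} \<Longrightarrow> A i \<in> sets (N i)"
    then have [measurable]: "\<And>i. i \<in> {..<k} \<Longrightarrow> A i \<in> sets borel" by (simp add: N_def)
    have vim: "(\<lambda>x. x / p) -` A i \<in> sets borel" if "i < k" for i
      using measurable_sets[of "\<lambda>x. x / p" borel borel "A i"] that by simp
    have "emeasure (distr (gamma_product k \<alpha>) (\<Pi>\<^sub>M i\<in>{..<k}. borel) (\<lambda>g. \<lambda>i\<in>{..<k}. g i / p)) (Pi\<^sub>E {..<k} A)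
        = emeasure (gamma_product k \<alpha>) ((\<lambda>g. \<lambda>i\<in>{..<k}. g i / p) -` (Pi\<^sub>E {..<k} A) \<inter> space (gamma_product k \<alpha>))"
      by (intro emeasure_distr) measurable
    also have "(\<lambda>g. \<lambda>i\<in>{..<k}. g i / p) -` (Pi\<^sub>E {..<k} A) \<inter> space (gamma_product k \<alpha>)
        = Pi\<^sub>E {..<k} (\<lambda>i. (\<lambda>x. x / p) -` A i)"
      by (auto simp: sp PiE_def Pi_def)
    also have "emeasure (gamma_product k \<alpha>) \<dots> = (\<Prod>i<k. emeasure (gamma_distr (\<alpha> i)) ((\<lambda>x. x / p) -` A i))"
      unfolding gamma_product_def by (intro G.emeasure_PiM) (auto simp: vim)
    also have "\<dots> = (\<Prod>i<k. emeasure (N i) (A i))"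
      unfolding N_def by (intro prod.cong refl) (simp add: emeasure_distr)
    finally show "emeasure (distr (gamma_product k \<alpha>) (\<Pi>\<^sub>M i\<in>{..<k}. borel) (\<lambda>g. \<lambda>i\<in>{..<k}. g i / p))
        (Pi\<^sub>E {..<k} A) = \<dots>" .
  qed (simp_all add: sN)
  also have "PiM {..<k} N = density (gamma_product k \<alpha>)
           (\<lambda>g. ennreal (p powr (\<Sum>i<k. \<alpha> i) * exp ((1 - p) * (\<Sum>i<k. g i))))"
  proof (rule N.PiM_eqI[symmetric])
    fix A assume A: "\<And>i. i \<in> {..<k} \<Longrightarrow> A i \<in> sets (N i)"
    then have [measurable]: "\<And>i. i \<in> {..<k} \<Longrightarrow> A i \<in> sets borel" by (simp add: N_def)
    have "emeasure (density (gamma_product k \<alpha>)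
           (\<lambda>g. ennreal (p powr (\<Sum>i<k. \<alpha> i) * exp ((1 - p) * (\<Sum>i<k. g i))))) (Pi\<^sub>E {..<k} A)
       = (\<integral>\<^sup>+g. (\<Prod>i<k. ennreal (p powr \<alpha> i * exp ((1 - p) * g i))) * indicator (Pi\<^sub>E {..<k} A) g \<partial>gamma_product k \<alpha>)"
      by (subst emeasure_density) (auto simp flip: dens)
    also have "\<dots> = (\<integral>\<^sup>+g. (\<Prod>i<k. ennreal (p powr \<alpha> i * exp ((1 - p) * g i)) * indicator (A i) (g i)) \<partial>gamma_product k \<alpha>)"
    proof (rule nn_integral_cong)
      fix g assume "g \<in> space (gamma_product k \<alpha>)"
      then have "indicator (Pi\<^sub>E {..<k} A) g = (\<Prod>i<k. indicator (A i) (g i) :: ennreal)"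
        by (auto simp: sp indicator_def PiE_def Pi_def intro!: prod.neutral[symmetric] prod_zero[symmetric])
      then show "(\<Prod>i<k. ennreal (p powr \<alpha> i * exp ((1 - p) * g i))) * indicator (Pi\<^sub>E {..<k} A) g
          = (\<Prod>i<k. ennreal (p powr \<alpha> i * exp ((1 - p) * g i)) * indicator (A i) (g i))"
        by (simp add: prod.distrib)
    qed
    also have "\<dots> = (\<Prod>i<k. \<integral>\<^sup>+x. ennreal (p powr \<alpha> i * exp ((1 - p) * x)) * indicator (A i) x \<partial>gamma_distr (\<alpha> i))"
      unfolding gamma_product_def by (intro G.product_nn_integral_prod) auto
    also have "\<dots> = (\<Prod>i<k. emeasure (N i) (A i))"
      using \<alpha> p by (intro prod.cong refl) (simp add: N_def gamma_distr_scale emeasure_density)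
    finally show "emeasure (density (gamma_product k \<alpha>)
           (\<lambda>g. ennreal (p powr (\<Sum>i<k. \<alpha> i) * exp ((1 - p) * (\<Sum>i<k. g i))))) (Pi\<^sub>E {..<k} A) = \<dots>" .
  qed (simp_all add: sN)
  finally show ?thesis .
qed

text \<open>A scale-invariant function does not see the rescaling, so that only the density of the tilted law
remains. In probabilistic terms the sum is independent of the ratios and has the Laplace transform of
a gamma variable.\<close>
lemma gamma_product_tilt:
  fixes \<phi> :: "(nat \<Rightarrow> real) \<Rightarrow> real"
  assumes \<alpha>: "\<And>i. i < k \<Longrightarrow> 0 \<le> \<alpha> i" and t: "0 \<le> t"
    and \<phi> [measurable]: "\<phi> \<in> borel_measurable (\<Pi>\<^sub>M i\<in>{..<k}. borel)"
    and inv: "\<And>g p. 0 < p \<Longrightarrow> \<phi> (\<lambda>i\<in>{..<k}. g i / p) = \<phi> g"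
  shows "(\<integral>g. exp (- t * (\<Sum>i<k. g i)) * \<phi> g \<partial>gamma_product k \<alpha>)
       = (1 + t) powr - (\<Sum>i<k. \<alpha> i) * (\<integral>g. \<phi> g \<partial>gamma_product k \<alpha>)"
proof -
  let ?N = "gamma_product k \<alpha>" and ?p = "1 + t"
  have "(\<integral>g. \<phi> g \<partial>?N) = (\<integral>g. \<phi> (\<lambda>i\<in>{..<k}. g i / ?p) \<partial>?N)"
    using inv[of ?p] t by simp
  also have "\<dots> = (\<integral>g. \<phi> g \<partial>distr ?N (\<Pi>\<^sub>M i\<in>{..<k}. borel) (\<lambda>g. \<lambda>i\<in>{..<k}. g i / ?p))"
    by (intro integral_distr[symmetric]) measurable
  also have "\<dots> = (\<integral>g. ?p powr (\<Sum>i<k. \<alpha> i) * exp ((1 - ?p) * (\<Sum>i<k. g i)) * \<phi> g \<partial>?N)"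
    using t by (subst gamma_product_scale[OF \<alpha>]) (auto simp: integral_density)
  also have "\<dots> = ?p powr (\<Sum>i<k. \<alpha> i) * (\<integral>g. exp (- t * (\<Sum>i<k. g i)) * \<phi> g \<partial>?N)"
    by (simp add: mult.assoc)
  finally show ?thesis
    using t by (simp flip: mult.assoc powr_add)
qed

text \<open>The positive part appears because the approximating simple functions live on the whole line, while
all the measures to which they are applied live on the half-line.\<close>
lemma simple_approx_pos_part:
  obtains s :: "nat \<Rightarrow> real \<Rightarrow> real" where
    "\<And>n. simple_function borel (s n)" "\<And>n x. 0 \<le> s n x" "\<And>n x. s n x \<le> max 0 x"
    "\<And>x. incseq (\<lambda>n. s n x)" "\<And>x. (\<lambda>n. s n x) \<longlonglongrightarrow> max 0 x"
proof -
  obtain f :: "nat \<Rightarrow> real \<Rightarrow> real" where f: "incseq f" "\<And>i. simple_function borel (f i)"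
    "\<And>x. bdd_above (range (\<lambda>i. f i x))" "\<And>i x. 0 \<le> f i x" "max 0 = (SUP i. f i)"
    using borel_measurable_implies_simple_function_sequence_real[of "max (0::real)" borel] by auto
  have inc: "incseq (\<lambda>n. f n x)" for x using f(1) by (auto simp: incseq_def le_fun_def)
  have sup: "(SUP i. f i x) = max 0 x" for x
    using fun_cong[OF f(5), of x] by (simp add: image_image)
  show thesis
  proof (rule that)
    fix x :: real
    show "(\<lambda>n. f n x) \<longlonglongrightarrow> max 0 x" using LIMSEQ_incseq_SUP[OF f(3) inc, of x] sup by simp
    fix n show "f n x \<le> max 0 x" using sup[of x] cSUP_upper[OF UNIV_I f(3), of n x] by simp
  qed (use f inc in auto)
qed

text \<open>Conditionally on the ratios, the sum is gamma distributed, so the exponential integrates to a power of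
\<open>1 + T g\<close>. The conditioning is made elementary: where \<open>T\<close> takes finitely many values, the claim is
the exponential tilt at each of them, and the general case is a limit.\<close>
lemma gamma_product_sum_indep_ratio:
  fixes T :: "(nat \<Rightarrow> real) \<Rightarrow> real"
  assumes \<alpha>: "\<And>i. i < k \<Longrightarrow> 0 \<le> \<alpha> i"
    and T [measurable]: "T \<in> borel_measurable (\<Pi>\<^sub>M i\<in>{..<k}. borel)"
    and inv: "\<And>g p. 0 < p \<Longrightarrow> T (\<lambda>i\<in>{..<k}. g i / p) = T g"
    and nonneg: "AE g in gamma_product k \<alpha>. 0 \<le> T g \<and> 0 \<le> (\<Sum>i<k. g i)"
  shows "(\<integral>g. exp (- T g * (\<Sum>i<k. g i)) \<partial>gamma_product k \<alpha>)
       = (\<integral>g. (1 + T g) powr - (\<Sum>i<k. \<alpha> i) \<partial>gamma_product k \<alpha>)"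
proof -
  let ?N = "gamma_product k \<alpha>" and ?S = "\<lambda>g::nat \<Rightarrow> real. \<Sum>i<k. g i" and ?\<theta> = "\<Sum>i<k. \<alpha> i"
  interpret prob_space ?N by (rule prob_space_gamma_product)
  have \<theta>: "0 \<le> ?\<theta>" using \<alpha> by (intro sum_nonneg) auto
  have simple: "(\<integral>g. exp (- s (T g) * ?S g) \<partial>?N) = (\<integral>g. (1 + s (T g)) powr - ?\<theta> \<partial>?N)"
    if s: "simple_function borel s" and s0: "\<And>x. 0 \<le> s x" for s :: "real \<Rightarrow> real"
  proof -
    have fin: "finite (range s)" using simple_functionD(1)[OF s] by simp
    have [measurable]: "s -` {v} \<in> sets borel" for v using simple_functionD(2)[OF s, of "{v}"] by simp
    have dec: "h (s x) = (\<Sum>v\<in>range s. h v * indicator (s -` {v}) x)" for h :: "real \<Rightarrow> real" and x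
      using fin by (subst sum.remove[of _ "s x"]) (auto intro!: sum.neutral)
    have int: "integrable ?N (\<lambda>g. exp (- v * ?S g) * indicator (s -` {v}) (T g))" if "v \<in> range s" for v
    proof (rule integrable_const_bound[where B=1])
      show "AE g in ?N. norm (exp (- v * ?S g) * indicator (s -` {v}) (T g)) \<le> 1"
        using nonneg by eventually_elim (use that s0 in \<open>auto simp: indicator_def\<close>)
    qed measurable
    have int': "integrable ?N (\<lambda>g. (1 + v) powr - ?\<theta> * indicator (s -` {v}) (T g))" for v
    proof (rule integrable_const_bound[where B="(1 + v) powr - ?\<theta>"])
      show "AE g in ?N. norm ((1 + v) powr - ?\<theta> * indicator (s -` {v}) (T g)) \<le> (1 + v) powr - ?\<theta>"
        by (intro AE_I2) (simp add: indicator_def)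
    qed measurable
    have "(\<integral>g. exp (- s (T g) * ?S g) \<partial>?N)
        = (\<integral>g. (\<Sum>v\<in>range s. exp (- v * ?S g) * indicator (s -` {v}) (T g)) \<partial>?N)"
    proof (rule Bochner_Integration.integral_cong[OF refl])
      fix g show "exp (- s (T g) * ?S g) = (\<Sum>v\<in>range s. exp (- v * ?S g) * indicator (s -` {v}) (T g))"
        by (rule dec[of "\<lambda>v. exp (- v * ?S g)" "T g"])
    qed
    also have "\<dots> = (\<Sum>v\<in>range s. \<integral>g. exp (- v * ?S g) * indicator (s -` {v}) (T g) \<partial>?N)"
      using int by (rule Bochner_Integration.integral_sum)
    also have "\<dots> = (\<Sum>v\<in>range s. \<integral>g. (1 + v) powr - ?\<theta> * indicator (s -` {v}) (T g) \<partial>?N)"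
    proof (intro sum.cong refl)
      fix v assume "v \<in> range s"
      then have "0 \<le> v" using s0 by auto
      then show "(\<integral>g. exp (- v * ?S g) * indicator (s -` {v}) (T g) \<partial>?N)
          = (\<integral>g. (1 + v) powr - ?\<theta> * indicator (s -` {v}) (T g) \<partial>?N)"
        by (subst gamma_product_tilt[OF \<alpha>]) (auto simp: inv)
    qed
    also have "\<dots> = (\<integral>g. (\<Sum>v\<in>range s. (1 + v) powr - ?\<theta> * indicator (s -` {v}) (T g)) \<partial>?N)"
      using int' by (rule Bochner_Integration.integral_sum[symmetric])
    also have "\<dots> = (\<integral>g. (1 + s (T g)) powr - ?\<theta> \<partial>?N)"
    proof (rule Bochner_Integration.integral_cong[OF refl])
      fix g show "(\<Sum>v\<in>range s. (1 + v) powr - ?\<theta> * indicator (s -` {v}) (T g)) = (1 + s (T g)) powr - ?\<theta>"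
        by (rule dec[of "\<lambda>v. (1 + v) powr - ?\<theta>" "T g", symmetric])
    qed
    finally show ?thesis .
  qed
  obtain s :: "nat \<Rightarrow> real \<Rightarrow> real" where s: "\<And>n. simple_function borel (s n)" "\<And>n x. 0 \<le> s n x"
    "\<And>x. (\<lambda>n. s n x) \<longlonglongrightarrow> max 0 x"
    by (rule simple_approx_pos_part) blast
  have lim: "(\<lambda>n. s n x) \<longlonglongrightarrow> x" if "0 \<le> x" for x
    using s(3)[of x] that by simp
  have [measurable]: "s n \<in> borel_measurable borel" for n
    using s(1) by (rule borel_measurable_simple_function)
  have "(\<lambda>n. \<integral>g. exp (- s n (T g) * ?S g) \<partial>?N) \<longlonglongrightarrow> (\<integral>g. exp (- T g * ?S g) \<partial>?N)"
  proof (rule integral_dominated_convergence[where w="\<lambda>_. 1"])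
    show "AE g in ?N. (\<lambda>n. exp (- s n (T g) * ?S g)) \<longlonglongrightarrow> exp (- T g * ?S g)"
      using nonneg by eventually_elim (auto intro!: tendsto_intros lim)
    show "AE g in ?N. norm (exp (- s n (T g) * ?S g)) \<le> 1" for n
      using nonneg by eventually_elim (use s(2) in auto)
  qed auto
  moreover have "(\<lambda>n. \<integral>g. (1 + s n (T g)) powr - ?\<theta> \<partial>?N) \<longlonglongrightarrow> (\<integral>g. (1 + T g) powr - ?\<theta> \<partial>?N)"
  proof (rule integral_dominated_convergence[where w="\<lambda>_. 1"])
    show "AE g in ?N. (\<lambda>n. (1 + s n (T g)) powr - ?\<theta>) \<longlonglongrightarrow> (1 + T g) powr - ?\<theta>"
      using nonneg by eventually_elim (auto intro!: tendsto_intros lim)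
    show "AE g in ?N. norm ((1 + s n (T g)) powr - ?\<theta>) \<le> 1" for n
      using s(2)[of n] \<theta> by (auto simp: powr_minus intro!: AE_I2 inverse_le_1_iff[THEN iffD2] ge_one_powr_ge_zero)
  qed auto
  ultimately show ?thesis
    unfolding simple[OF s(1,2)] by (rule LIMSEQ_unique)
qed

lemma sets_dirichlet_distr [simp, measurable_cong]:
  "sets (dirichlet_distr k \<alpha>) = sets (\<Pi>\<^sub>M i\<in>{..<k}. borel)"
  by (simp add: dirichlet_distr_def)

text \<open>Write \<open>d i = g i / S\<close> with independent gamma variables \<open>g i\<close> and their sum \<open>S\<close>. Independence of \<open>S\<close> and
the ratios replaces \<open>(1 + \<Sum>i. w i * d i) powr - \<theta>\<close> by \<open>exp (- \<Sum>i. w i * g i)\<close>, whose expectation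
factorises.\<close>
lemma dirichlet_distr_transform:
  assumes \<alpha>: "\<And>i. i < k \<Longrightarrow> 0 \<le> \<alpha> i" and w: "\<And>i. i < k \<Longrightarrow> 0 \<le> w i"
  shows "(\<integral>d. (1 + (\<Sum>i<k. w i * d i)) powr - (\<Sum>i<k. \<alpha> i) \<partial>dirichlet_distr k \<alpha>)
       = (\<Prod>i<k. (1 + w i) powr - \<alpha> i)"
proof -
  let ?N = "gamma_product k \<alpha>" and ?S = "\<lambda>g::nat \<Rightarrow> real. \<Sum>i<k. g i" and ?\<theta> = "\<Sum>i<k. \<alpha> i"
  let ?T = "\<lambda>g. (\<Sum>i<k. w i * (g i / ?S g))"
  interpret prob_space ?N by (rule prob_space_gamma_product)
  interpret G: product_prob_space "\<lambda>i. gamma_distr (\<alpha> i)"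
    by (simp add: product_prob_spaceI prob_space_gamma_distr)
  have pos: "AE g in ?N. \<forall>i\<in>{..<k}. 0 \<le> g i"
    unfolding gamma_product_def
    by (intro AE_finite_allI AE_PiM_component AE_gamma_distr_nonneg prob_space_gamma_distr) auto
  have "(\<integral>d. (1 + (\<Sum>i<k. w i * d i)) powr - ?\<theta> \<partial>dirichlet_distr k \<alpha>)
      = (\<integral>g. (1 + ?T g) powr - ?\<theta> \<partial>?N)"
    unfolding dirichlet_distr_def gamma_product_def[symmetric]
    by (subst integral_distr) simp_all
  also have "\<dots> = (\<integral>g. exp (- ?T g * ?S g) \<partial>?N)"
  proof (rule gamma_product_sum_indep_ratio[symmetric, OF \<alpha>])
    show "?T (\<lambda>i\<in>{..<k}. g i / p) = ?T g" if "0 < p" for g p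
      using that by (intro sum.cong refl) (simp flip: sum_divide_distrib)
    show "AE g in ?N. 0 \<le> ?T g \<and> 0 \<le> ?S g"
      using pos by eventually_elim (auto intro!: sum_nonneg mult_nonneg_nonneg divide_nonneg_nonneg w)
  qed auto
  also have "\<dots> = (\<integral>g. (\<Prod>i<k. exp (- w i * g i)) \<partial>?N)"
  proof (rule integral_cong_AE)
    show "AE g in ?N. exp (- ?T g * ?S g) = (\<Prod>i<k. exp (- w i * g i))"
      using pos
    proof eventually_elim
      case (elim g)
      \<comment> \<open>if the sum vanishes then all gamma variables vanish, so the value of \<open>g i / 0\<close> is irrelevant\<close>
      have "?T g * ?S g = (\<Sum>i<k. w i * g i)"
      proof (cases "?S g = 0")
        case True
        then have "\<forall>i\<in>{..<k}. g i = 0" using elim by (subst (asm) sum_nonneg_eq_0_iff) auto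
        then show ?thesis by simp
      next
        case False
        then show ?thesis by (simp add: sum_distrib_right)
      qed
      then show ?case by (simp flip: exp_sum add: sum_negf)
    qed
  qed auto
  also have "\<dots> = enn2real (\<integral>\<^sup>+g. ennreal (\<Prod>i<k. exp (- w i * g i)) \<partial>?N)"
    by (intro integral_eq_nn_integral) (auto intro!: prod_nonneg)
  also have "(\<integral>\<^sup>+g. ennreal (\<Prod>i<k. exp (- w i * g i)) \<partial>?N)
      = (\<integral>\<^sup>+g. (\<Prod>i<k. ennreal (exp (- w i * g i))) \<partial>?N)"
    by (simp add: prod_ennreal)
  also have "\<dots> = (\<Prod>i<k. \<integral>\<^sup>+x. ennreal (exp (- w i * x)) \<partial>gamma_distr (\<alpha> i))"
    unfolding gamma_product_def by (intro G.product_nn_integral_prod) auto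
  also have "\<dots> = (\<Prod>i<k. ennreal ((1 + w i) powr - \<alpha> i))"
    using \<alpha> w by (intro prod.cong refl gamma_distr_exp_integral) auto
  also have "\<dots> = ennreal (\<Prod>i<k. (1 + w i) powr - \<alpha> i)"
    by (simp add: prod_ennreal)
  finally show ?thesis by (simp add: prod_nonneg)
qed

section \<open>Logarithmic and Riesz potentials on the half-line\<close>

text \<open>The kernel \<open>\<bar>y\<bar> powr - q\<close> is cut off at distance 1 to be Lebesgue integrable on the line; at the origin
its value is 0, which changes it on a null set only.\<close>
definition riesz_kernel :: "real \<Rightarrow> real \<Rightarrow> real" where
  "riesz_kernel q y = (if \<bar>y\<bar> \<le> 1 then \<bar>y\<bar> powr - q else 0)"

lemma borel_measurable_riesz_kernel [measurable]: "riesz_kernel q \<in> borel_measurable borel"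
  unfolding riesz_kernel_def by measurable

lemma riesz_kernel_nonneg: "0 \<le> riesz_kernel q y" by (simp add: riesz_kernel_def)

lemma nn_integral_riesz_kernel_less_top:
  assumes "q < 1"
  shows "(\<integral>\<^sup>+y. ennreal (riesz_kernel q y) \<partial>lborel) < \<infinity>"
proof -
  let ?h = "\<lambda>y::real. ennreal (y powr - q) * indicator {0..1} y"
  have h: "(\<integral>\<^sup>+y. ?h y \<partial>lborel) < \<infinity>"
  proof -
    have "((\<lambda>y. y powr - q) has_integral (1 powr (- q + 1) / (- q + 1))) {0..1::real}"
      using assms by (intro has_integral_powr_from_0) auto
    from nn_integral_has_integral_lebesgue'[OF _ this] show ?thesis by simp
  qed
  have "(\<integral>\<^sup>+y. ennreal (riesz_kernel q y) \<partial>lborel) \<le> (\<integral>\<^sup>+y. ?h y + ?h (- y) \<partial>lborel)"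
    by (intro nn_integral_mono) (auto simp: riesz_kernel_def indicator_def)
  also have "\<dots> = (\<integral>\<^sup>+y. ?h y \<partial>lborel) + (\<integral>\<^sup>+y. ?h (- y) \<partial>lborel)"
    by (intro nn_integral_add) auto
  also have "(\<integral>\<^sup>+y. ?h (- y) \<partial>lborel) = (\<integral>\<^sup>+y. ?h y \<partial>lborel)"
    by (subst (2) nn_integral_real_affine[where c="-1" and t=0]) auto
  finally show ?thesis using h by (simp add: ennreal_add_less_top le_less_trans)
qed

text \<open>The laws on the half-line for which the logarithmic transform \<open>psi\<close> is finite.\<close>
locale half_line_prob = prob_space F for F :: "real measure" +
  assumes sets_F [simp, measurable_cong]: "sets F = sets borel"
    and nonneg: "AE t in F. 0 \<le> t"
    and log_integrable: "\<And>l. 0 < l \<Longrightarrow> integrable F (\<lambda>t. ln (1 + l * t))"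
begin

lemma space_F [simp]: "space F = UNIV"
  using sets_eq_imp_space_eq[OF sets_F] by simp

definition riesz_potential :: "real \<Rightarrow> real \<Rightarrow> ennreal" where
  "riesz_potential q x = (\<integral>\<^sup>+t. ennreal (riesz_kernel q (x - t)) \<partial>F)"

lemma borel_measurable_riesz_potential [measurable]: "riesz_potential q \<in> borel_measurable borel"
  unfolding riesz_potential_def by measurable

text \<open>Tonelli's theorem reduces this to the integrability of the kernel, since translations do not change
its Lebesgue integral.\<close>
lemma nn_integral_riesz_potential_less_top:
  assumes "q < 1"
  shows "(\<integral>\<^sup>+x. riesz_potential q x \<partial>lborel) < \<infinity>"
proof -
  interpret P: pair_sigma_finite lborel F by unfold_locales
  have "(\<integral>\<^sup>+x. riesz_potential q x \<partial>lborel) = (\<integral>\<^sup>+t. \<integral>\<^sup>+x. ennreal (riesz_kernel q (x - t)) \<partial>lborel \<partial>F)"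
    unfolding riesz_potential_def by (rule P.Fubini'[symmetric]) measurable
  also have "\<dots> = (\<integral>\<^sup>+t. \<integral>\<^sup>+x. ennreal (riesz_kernel q x) \<partial>lborel \<partial>F)"
  proof (rule nn_integral_cong)
    fix t
    show "(\<integral>\<^sup>+x. ennreal (riesz_kernel q (x - t)) \<partial>lborel) = (\<integral>\<^sup>+x. ennreal (riesz_kernel q x) \<partial>lborel)"
      by (subst nn_integral_real_affine[where c=1 and t=t]) auto
  qed
  also have "\<dots> < \<infinity>" using nn_integral_riesz_kernel_less_top[OF assms] emeasure_space_1 by simp
  finally show ?thesis .
qed

lemma AE_riesz_potential_less_top:
  assumes "q < 1" shows "AE x in lborel. riesz_potential q x < \<infinity>"
  using nn_integral_riesz_potential_less_top[OF assms] nn_integral_PInf_AE[of "riesz_potential q" lborel]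
  by (auto simp: less_top)

lemma AE_lborel_no_atom: "AE x in lborel. measure F {x} = 0"
proof -
  have "countable {x. measure F {x} \<noteq> 0}" by (rule countable_support)
  then have "{x. measure F {x} \<noteq> 0} \<in> null_sets lborel" by (rule countable_imp_null_set_lborel)
  then show ?thesis by (rule AE_I') auto
qed

lemma AE_neq_of_no_atom: "measure F {x} = 0 \<Longrightarrow> AE t in F. t \<noteq> x"
  by (rule AE_I[where N="{x}"]) (auto simp: emeasure_eq_measure)

text \<open>The negative part of the logarithm is dominated by any negative power near the origin; the exponent
one half is an arbitrary choice. The positive part grows like \<open>ln (1 + t)\<close>.\<close>
lemma abs_ln_le_riesz_kernel:
  assumes "0 \<le> t"
  shows "\<bar>ln \<bar>x - t\<bar>\<bar> \<le> 2 * riesz_kernel (1 / 2) (x - t) + ln (1 + \<bar>x\<bar>) + ln (1 + t)"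
proof -
  have l: "0 \<le> ln (1 + \<bar>x\<bar>)" "0 \<le> ln (1 + t)" using assms by auto
  consider "x = t" | "x \<noteq> t" "\<bar>x - t\<bar> \<le> 1" | "1 < \<bar>x - t\<bar>" by linarith
  then show ?thesis
  proof cases
    case 1
    then show ?thesis using l by (simp add: riesz_kernel_def)
  next
    case 2
    define y where "y = \<bar>x - t\<bar>"
    have y: "0 < y" "y \<le> 1" using 2 by (auto simp: y_def)
    have "- ln y = 2 * ln (y powr - (1 / 2))" using y by (simp add: ln_powr)
    also have "\<dots> \<le> 2 * y powr - (1 / 2)" using ln_bound[of "y powr - (1 / 2)"] y by simp
    finally have "\<bar>ln y\<bar> \<le> 2 * y powr - (1 / 2)" using y by simp
    moreover have "riesz_kernel (1 / 2) (x - t) = y powr - (1 / 2)" using 2(2) by (simp add: riesz_kernel_def y_def)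
    ultimately show ?thesis using l unfolding y_def by linarith
  next
    case 3
    have "\<bar>x - t\<bar> \<le> (1 + \<bar>x\<bar>) * (1 + t)"
    proof -
      have "\<bar>x - t\<bar> \<le> \<bar>x\<bar> + t" using assms by simp
      also have "\<dots> \<le> (1 + \<bar>x\<bar>) * (1 + t)" using assms by (simp add: algebra_simps)
      finally show ?thesis .
    qed
    then have "ln \<bar>x - t\<bar> \<le> ln ((1 + \<bar>x\<bar>) * (1 + t))" using 3 by (intro ln_le_cancel_iff[THEN iffD2]) auto
    also have "\<dots> = ln (1 + \<bar>x\<bar>) + ln (1 + t)" using assms by (subst ln_mult) auto
    finally show ?thesis using 3 riesz_kernel_nonneg[of "1/2" "x - t"] by simp
  qed
qed

lemma integrable_riesz_kernel:
  assumes "riesz_potential q x < \<infinity>"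
  shows "integrable F (\<lambda>t. riesz_kernel q (x - t))"
  using assms unfolding riesz_potential_def
  by (intro integrableI_nonneg) (auto simp: riesz_kernel_nonneg)

text \<open>For almost every \<open>x\<close> the majorant of \<open>abs_ln_le_riesz_kernel\<close> has a finite integral. Hence \<open>Phi F\<close> is
given by a convergent integral outside a Lebesgue null set.\<close>
lemma AE_log_potential_integrable: "AE x in lborel. integrable F (\<lambda>t. ln \<bar>x - t\<bar>)"
proof -
  have "AE x in lborel. riesz_potential (1 / 2) x < \<infinity>" by (rule AE_riesz_potential_less_top) simp
  then show ?thesis
  proof eventually_elim
    case (elim x)
    have "integrable F (\<lambda>t. 2 * riesz_kernel (1 / 2) (x - t) + ln (1 + \<bar>x\<bar>) + ln (1 + t))"
      using integrable_riesz_kernel[OF elim] log_integrable[of 1] by simp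
    then show ?case
    proof (rule Bochner_Integration.integrable_bound)
      show "AE t in F. norm (ln \<bar>x - t\<bar>) \<le> norm (2 * riesz_kernel (1 / 2) (x - t) + ln (1 + \<bar>x\<bar>) + ln (1 + t))"
        using nonneg
      proof eventually_elim
        case (elim t)
        show ?case using abs_ln_le_riesz_kernel[OF elim, of x] by simp
      qed
    qed measurable
  qed
qed

lemma borel_measurable_Phi [measurable]: "Phi F \<in> borel_measurable borel"
  unfolding Phi_def by measurable

text \<open>The indicator in the definition of \<open>Phi\<close> excludes the point \<open>t = x\<close>, where \<open>ln 0 = 0\<close> anyway.\<close>
lemma Phi_eq: "Phi F x = (\<integral>t. ln \<bar>x - t\<bar> \<partial>F)"
  unfolding Phi_def by (intro Bochner_Integration.integral_cong) (auto simp: indicator_def)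

lemma borel_measurable_cdf [measurable]: "cdf F \<in> borel_measurable borel"
  by (intro borel_measurable_mono monoI) (auto simp: cdf_def intro!: finite_measure_mono)

end

section \<open>The Markov--Krein identity\<close>
lemma dirichlet_processD:
  assumes "dirichlet_process \<Omega> \<theta> F P"
  shows "prob_space \<Omega>"
    and "P \<in> \<Omega> \<rightarrow>\<^sub>M subprob_algebra (restrict_space borel {0..})"
    and "\<omega> \<in> space \<Omega> \<Longrightarrow> prob_space (P \<omega>)"
    and "\<omega> \<in> space \<Omega> \<Longrightarrow> sets (P \<omega>) = sets (restrict_space borel {0..})"
    and "\<omega> \<in> space \<Omega> \<Longrightarrow> space (P \<omega>) = {0..}"
proof -
  have P: "P \<in> \<Omega> \<rightarrow>\<^sub>M prob_algebra (restrict_space borel {0..})" and \<Omega>: "prob_space \<Omega>"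
    using assms by (auto simp: dirichlet_process_def)
  show "prob_space \<Omega>" by fact
  show "P \<in> \<Omega> \<rightarrow>\<^sub>M subprob_algebra (restrict_space borel {0..})"
    using P by (rule measurable_prob_algebraD)
  assume \<omega>: "\<omega> \<in> space \<Omega>"
  from measurable_space[OF P \<omega>]
  show "prob_space (P \<omega>)" and s: "sets (P \<omega>) = sets (restrict_space borel {0..})"
    by (auto simp: space_prob_algebra)
  from sets_eq_imp_space_eq[OF s] show "space (P \<omega>) = {0..}"
    by (simp add: space_restrict_space)
qed

text \<open>The Markov--Krein identity for simple functions. The level sets of \<open>s\<close> form a finite partition, on
which the process has a Dirichlet distribution; the value of \<open>s\<close> on each of them is the weight in
the transform of that distribution.\<close>
lemma dirichlet_process_transform_simple:
  assumes dp: "dirichlet_process \<Omega> \<theta> F P" and \<theta>: "0 \<le> \<theta>"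
    and F: "prob_space F" and sF: "sets F = sets borel" and pos: "AE x in F. 0 \<le> x"
    and s: "simple_function borel s" and s0: "\<And>x. 0 \<le> s x"
  shows "(\<integral>\<omega>. (1 + (\<integral>x. s x \<partial>P \<omega>)) powr - \<theta> \<partial>\<Omega>) = exp (- \<theta> * (\<integral>x. ln (1 + s x) \<partial>F))"
proof -
  interpret F: prob_space F by fact
  note [measurable_cong] = sF
  define V where "V = s ` {0..}"
  have "finite (range s)" using simple_functionD(1)[OF s] by simp
  then have "finite V" unfolding V_def by (rule finite_subset[rotated]) auto
  then obtain h where h: "bij_betw h {..<card V} V"
    using ex_bij_betw_nat_finite by (metis atLeast0LessThan)
  define k where "k = card V"
  note h = h[folded k_def]
  define C where "C i = s -` {h i} \<inter> {0..}" for i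
  have [measurable]: "s -` {v} \<in> sets borel" for v using simple_functionD(2)[OF s, of "{v}"] by simp
  have C [measurable]: "C i \<in> sets borel" for i by (simp add: C_def)
  have C': "C i \<in> sets (restrict_space borel {0..})" for i
    by (subst sets_restrict_space_iff) (auto simp: C_def)
  have disj: "disjoint_family_on C {..<k}"
    using bij_betw_imp_inj_on[OF h] by (auto simp: disjoint_family_on_def C_def inj_on_def)
  have un: "(\<Union>i<k. C i) = {0..}"
    using bij_betw_imp_surj_on[OF h] unfolding C_def V_def by fastforce
  have h0: "0 \<le> h i" if "i < k" for i
  proof -
    have "h i \<in> V" using bij_betw_apply[OF h] that by simp
    then show ?thesis using s0 by (auto simp: V_def)
  qed
  have dec: "f (s x) = (\<Sum>i<k. f (h i) * indicator (C i) x)" if "0 \<le> x" for f :: "real \<Rightarrow> real" and x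
  proof -
    obtain j where j: "j < k" "x \<in> C j" using un \<open>0 \<le> x\<close> by auto
    have "(\<Sum>i<k. f (h i) * indicator (C i) x) = (\<Sum>i<k. if i = j then f (s x) else 0)"
      using disj j by (intro sum.cong) (auto simp: disjoint_family_on_def C_def indicator_def)
    then show ?thesis using j by simp
  qed
  let ?\<alpha> = "\<lambda>i. \<theta> * measure F (C i)"
  have law: "distr \<Omega> (\<Pi>\<^sub>M i\<in>{..<k}. borel) (\<lambda>\<omega>. \<lambda>i\<in>{..<k}. measure (P \<omega>) (C i)) = dirichlet_distr k ?\<alpha>"
    using dp disj un unfolding dirichlet_process_def by (simp add: C)
  have [measurable]: "(\<lambda>\<omega>. measure (P \<omega>) (C i)) \<in> borel_measurable \<Omega>" for i
    using measurable_compose[OF dirichlet_processD(2)[OF dp] measurable_measure_subprob_algebra[OF C']]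
    by simp
  have sum\<alpha>: "(\<Sum>i<k. ?\<alpha> i) = \<theta>"
  proof -
    have "(\<Sum>i<k. measure F (C i)) = measure F (\<Union>i<k. C i)"
      using disj by (intro F.finite_measure_finite_Union[symmetric]) auto
    also have "\<dots> = 1" unfolding un using pos by (intro F.prob_eq_1[THEN iffD2]) (auto simp: sF)
    finally show ?thesis by (simp flip: sum_distrib_left)
  qed
  have "(\<integral>\<omega>. (1 + (\<integral>x. s x \<partial>P \<omega>)) powr - \<theta> \<partial>\<Omega>)
      = (\<integral>\<omega>. (1 + (\<Sum>i<k. h i * measure (P \<omega>) (C i))) powr - \<theta> \<partial>\<Omega>)"
  proof (rule Bochner_Integration.integral_cong[OF refl])
    fix \<omega> assume \<omega>: "\<omega> \<in> space \<Omega>"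
    interpret prob_space "P \<omega>" by (rule dirichlet_processD(3)[OF dp \<omega>])
    have [measurable]: "C i \<in> sets (P \<omega>)" for i
      using C' dirichlet_processD(4)[OF dp \<omega>] by simp
    have "(\<integral>x. s x \<partial>P \<omega>) = (\<integral>x. (\<Sum>i<k. h i * indicator (C i) x) \<partial>P \<omega>)"
      using dec[of _ "\<lambda>x. x"] dirichlet_processD(5)[OF dp \<omega>] by (intro Bochner_Integration.integral_cong) auto
    also have "\<dots> = (\<Sum>i<k. h i * measure (P \<omega>) (C i))"
      by (subst Bochner_Integration.integral_sum) (auto simp: less_top[symmetric])
    finally show "(1 + (\<integral>x. s x \<partial>P \<omega>)) powr - \<theta> = (1 + (\<Sum>i<k. h i * measure (P \<omega>) (C i))) powr - \<theta>"
      by simp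
  qed
  also have "\<dots> = (\<integral>d. (1 + (\<Sum>i<k. h i * d i)) powr - \<theta> \<partial>dirichlet_distr k ?\<alpha>)"
    unfolding law[symmetric] by (subst integral_distr) simp_all
  also have "\<dots> = (\<Prod>i<k. (1 + h i) powr - ?\<alpha> i)"
    using dirichlet_distr_transform[of k ?\<alpha> h] h0 \<theta> unfolding sum\<alpha> by simp
  also have "\<dots> = exp (- \<theta> * (\<Sum>i<k. ln (1 + h i) * measure F (C i)))"
  proof -
    have "(1 + h i) powr - ?\<alpha> i = exp (- \<theta> * (ln (1 + h i) * measure F (C i)))" if "i < k" for i
      using h0[OF that] by (simp add: powr_def mult_ac)
    then show ?thesis by (simp add: exp_sum sum_distrib_left)
  qed
  also have "(\<Sum>i<k. ln (1 + h i) * measure F (C i)) = (\<integral>x. (\<Sum>i<k. ln (1 + h i) * indicator (C i) x) \<partial>F)"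
    by (subst Bochner_Integration.integral_sum) (auto simp: less_top[symmetric])
  also have "\<dots> = (\<integral>x. ln (1 + s x) \<partial>F)"
  proof (rule integral_cong_AE)
    show "AE x in F. (\<Sum>i<k. ln (1 + h i) * indicator (C i) x) = ln (1 + s x)"
      using pos by eventually_elim (rule dec[of _ "\<lambda>y. ln (1 + y)", symmetric])
    have "s \<in> borel_measurable F" using borel_measurable_simple_function[OF s] sF by simp
    then show "(\<lambda>x. ln (1 + s x)) \<in> borel_measurable F" by simp
  qed measurable
  finally show ?thesis .
qed

text \<open>The Markov--Krein identity. Simple functions increasing to the identity give it with the convention
that \<open>(1 + z * \<infinity>) powr - \<theta> = 0\<close>. Letting \<open>z\<close> tend to 0, the right-hand side tends to 1 while the left-hand side
tends to the probability that the mean integral converges, so this integral is almost surely finite.\<close>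
lemma (in half_line_prob) dirichlet_process_mean_transform:
  assumes dp: "dirichlet_process \<Omega> \<theta> F P" and \<theta>: "0 < \<theta>"
  shows borel_measurable_dirichlet_mean: "dirichlet_mean P \<in> borel_measurable \<Omega>"
    and dirichlet_mean_nonneg: "\<And>\<omega>. \<omega> \<in> space \<Omega> \<Longrightarrow> 0 \<le> dirichlet_mean P \<omega>"
    and dirichlet_mean_transform:
      "\<And>z. 0 < z \<Longrightarrow> (\<integral>\<omega>. (1 + z * dirichlet_mean P \<omega>) powr - \<theta> \<partial>\<Omega>) = exp (- \<theta> * psi F z)"
proof -
  interpret \<Omega>: prob_space \<Omega> by (rule dirichlet_processD(1)[OF dp])
  have mP: "f \<in> borel_measurable (P \<omega>)" if "\<omega> \<in> space \<Omega>" "f \<in> borel_measurable borel"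
    for f :: "real \<Rightarrow> real" and \<omega>
    using measurable_restrict_space1[OF that(2)]
    unfolding measurable_cong_sets[OF dirichlet_processD(4)[OF dp that(1)] refl] .
  define E where "E \<omega> = (\<integral>\<^sup>+x. ennreal x \<partial>P \<omega>)" for \<omega>
  have [measurable]: "E \<in> borel_measurable \<Omega>"
    unfolding E_def
    by (rule measurable_compose[OF dirichlet_processD(2)[OF dp] nn_integral_measurable_subprob_algebra])
       (rule measurable_restrict_space1, measurable)
  have mean: "dirichlet_mean P \<omega> = enn2real (E \<omega>)" if "\<omega> \<in> space \<Omega>" for \<omega>
    unfolding dirichlet_mean_def E_def
  proof (rule integral_eq_nn_integral)
    show "(\<lambda>x. x) \<in> borel_measurable (P \<omega>)" by (rule mP[OF that]) simp
    show "AE x in P \<omega>. 0 \<le> x" using dirichlet_processD(5)[OF dp that] by (intro AE_I2) simp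
  qed
  show meas [measurable]: "dirichlet_mean P \<in> borel_measurable \<Omega>"
    using mean by (subst measurable_cong) auto
  show mean_nonneg: "0 \<le> dirichlet_mean P \<omega>" if "\<omega> \<in> space \<Omega>" for \<omega>
    using mean[OF that] by simp
  obtain s :: "nat \<Rightarrow> real \<Rightarrow> real" where s: "\<And>n. simple_function borel (s n)" "\<And>n x. 0 \<le> s n x"
    "\<And>n x. s n x \<le> max 0 x" "\<And>x. incseq (\<lambda>n. s n x)" "\<And>x. (\<lambda>n. s n x) \<longlonglongrightarrow> max 0 x"
    by (rule simple_approx_pos_part) blast
  have s_le: "s n x \<le> x" and s_lim: "(\<lambda>n. s n x) \<longlonglongrightarrow> x" if "0 \<le> x" for n x
    using s(3)[of n x] s(5)[of x] that by simp_all
  have ms [measurable]: "s n \<in> borel_measurable borel" for n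
    using s(1) by (rule borel_measurable_simple_function)
  define m where "m n \<omega> = (\<integral>x. s n x \<partial>P \<omega>)" for n \<omega>
  have m: "ennreal (m n \<omega>) = (\<integral>\<^sup>+x. ennreal (s n x) \<partial>P \<omega>)" "0 \<le> m n \<omega>" if \<omega>: "\<omega> \<in> space \<Omega>" for n \<omega>
  proof -
    interpret P: prob_space "P \<omega>" by (rule dirichlet_processD(3)[OF dp \<omega>])
    have "finite (range (s n))" using simple_functionD(1)[OF s(1)[of n]] by simp
    then have "s n x \<le> Max (range (s n))" for x by simp
    then have "integrable (P \<omega>) (s n)"
      using s(2) mP[OF \<omega> ms[of n]] by (intro P.integrable_const_bound[where B="Max (range (s n))"]) auto
    then show "ennreal (m n \<omega>) = (\<integral>\<^sup>+x. ennreal (s n x) \<partial>P \<omega>)"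
      unfolding m_def using s(2) by (intro nn_integral_eq_integral[symmetric]) auto
    show "0 \<le> m n \<omega>" unfolding m_def using s(2) by simp
  qed
  have [measurable]: "m n \<in> borel_measurable \<Omega>" for n
  proof -
    have "(\<lambda>\<omega>. \<integral>\<^sup>+x. ennreal (s n x) \<partial>P \<omega>) \<in> borel_measurable \<Omega>"
      by (rule measurable_compose[OF dirichlet_processD(2)[OF dp] nn_integral_measurable_subprob_algebra])
         (rule measurable_restrict_space1, measurable)
    then have "(\<lambda>\<omega>. enn2real (\<integral>\<^sup>+x. ennreal (s n x) \<partial>P \<omega>)) \<in> borel_measurable \<Omega>" by measurable
    moreover have "m n \<omega> = enn2real (\<integral>\<^sup>+x. ennreal (s n x) \<partial>P \<omega>)" if "\<omega> \<in> space \<Omega>" for \<omega>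
      using m[OF that, of n] by (metis enn2real_ennreal)
    ultimately show ?thesis by (subst measurable_cong) auto
  qed
  have lim: "(\<lambda>n. ennreal (m n \<omega>)) \<longlonglongrightarrow> E \<omega>" if \<omega>: "\<omega> \<in> space \<Omega>" for \<omega>
    unfolding E_def m(1)[OF \<omega>]
  proof (rule nn_integral_LIMSEQ)
    show "incseq (\<lambda>n x. ennreal (s n x))"
      using s(4) by (auto simp: incseq_def le_fun_def intro!: ennreal_leI)
    show "(\<lambda>x. ennreal (s n x)) \<in> borel_measurable (P \<omega>)" for n
      using mP[OF \<omega> ms[of n]] by simp
    show "(\<lambda>n. ennreal (s n x)) \<longlonglongrightarrow> ennreal x" for x
      using tendsto_ennrealI[OF s(5)[of x]] by (simp add: max_def ennreal_neg split: if_splits)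
  qed
  \<comment> \<open>the limit of the integrands, with value 0 where the mean integral diverges\<close>
  define g where "g z \<omega> = (if E \<omega> = \<infinity> then 0 else (1 + z * dirichlet_mean P \<omega>) powr - \<theta>)" for z \<omega>
  have [measurable]: "g z \<in> borel_measurable \<Omega>" for z unfolding g_def by measurable
  have powr_le_1: "(1 + z * y) powr - \<theta> \<le> 1" if "0 < z" "0 \<le> y" for z y
    using that \<theta> by (simp add: powr_minus inverse_le_1_iff ge_one_powr_ge_zero)
  have g_lim: "(\<lambda>n. (1 + z * m n \<omega>) powr - \<theta>) \<longlonglongrightarrow> g z \<omega>" if \<omega>: "\<omega> \<in> space \<Omega>" and z: "0 < z" for z \<omega>
  proof (cases "E \<omega> = \<infinity>")
    case True
    have "filterlim (\<lambda>n. m n \<omega>) at_top sequentially"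
      using lim[OF \<omega>] True m(2)[OF \<omega>] by (simp add: ennreal_tendsto_top_eq_at_top)
    then have "filterlim (\<lambda>n. 1 + z * m n \<omega>) at_top sequentially"
      using z by (intro filterlim_tendsto_add_at_top[OF tendsto_const] filterlim_tendsto_pos_mult_at_top[OF tendsto_const])
    then have "(\<lambda>n. (1 + z * m n \<omega>) powr - \<theta>) \<longlonglongrightarrow> 0"
      using \<theta> by (intro tendsto_neg_powr) auto
    then show ?thesis using True by (simp add: g_def)
  next
    case False
    then have "(\<lambda>n. ennreal (m n \<omega>)) \<longlonglongrightarrow> ennreal (dirichlet_mean P \<omega>)"
      using lim[OF \<omega>] mean[OF \<omega>] by (simp add: less_top)
    then have "(\<lambda>n. m n \<omega>) \<longlonglongrightarrow> dirichlet_mean P \<omega>"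
      using m(2)[OF \<omega>] mean_nonneg[OF \<omega>] by (subst (asm) tendsto_ennreal_iff) auto
    then have "(\<lambda>n. (1 + z * m n \<omega>) powr - \<theta>) \<longlonglongrightarrow> (1 + z * dirichlet_mean P \<omega>) powr - \<theta>"
      using mean_nonneg[OF \<omega>] z by (intro tendsto_intros) (auto simp: add_nonneg_eq_0_iff)
    then show ?thesis using False by (simp add: g_def)
  qed
  have g_int: "(\<integral>\<omega>. g z \<omega> \<partial>\<Omega>) = exp (- \<theta> * psi F z)" if z: "0 < z" for z
  proof -
    have "(\<lambda>n. \<integral>\<omega>. (1 + z * m n \<omega>) powr - \<theta> \<partial>\<Omega>) \<longlonglongrightarrow> (\<integral>\<omega>. g z \<omega> \<partial>\<Omega>)"
      using g_lim z m(2) powr_le_1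
      by (intro integral_dominated_convergence[where w="\<lambda>_. 1"]) auto
    moreover have "(\<integral>\<omega>. (1 + z * m n \<omega>) powr - \<theta> \<partial>\<Omega>) = exp (- \<theta> * (\<integral>x. ln (1 + z * s n x) \<partial>F))" for n
    proof -
      have "simple_function borel (\<lambda>x. z * s n x)" using s(1) by (intro simple_function_mult) auto
      from dirichlet_process_transform_simple[OF dp _ prob_space_axioms sets_F nonneg this]
      show ?thesis using \<theta> z s(2) by (simp add: m_def)
    qed
    moreover have "(\<lambda>n. exp (- \<theta> * (\<integral>x. ln (1 + z * s n x) \<partial>F))) \<longlonglongrightarrow> exp (- \<theta> * psi F z)"
      unfolding psi_def
    proof (intro tendsto_intros integral_dominated_convergence[where w="\<lambda>x. ln (1 + z * x)"])
      show "AE x in F. (\<lambda>n. ln (1 + z * s n x)) \<longlonglongrightarrow> ln (1 + z * x)"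
        using nonneg by eventually_elim
          (use z in \<open>auto intro!: tendsto_intros s_lim simp: add_nonneg_eq_0_iff\<close>)
      show "AE x in F. norm (ln (1 + z * s n x)) \<le> ln (1 + z * x)" for n
        using nonneg by eventually_elim (use z s(2) s_le in \<open>auto intro!: ln_le_cancel_iff[THEN iffD2] mult_left_mono add_pos_nonneg\<close>)
    qed (use log_integrable z in auto)
    ultimately show ?thesis by (simp add: LIMSEQ_unique)
  qed
  \<comment> \<open>now \<open>z\<close> tends to 0, which leaves the probability that \<open>E\<close> is finite\<close>
  define u where "u n = 1 / real (Suc n)" for n
  have u: "0 < u n" "u n \<le> 1" for n by (auto simp: u_def)
  have u_lim: "u \<longlonglongrightarrow> 0" unfolding u_def by (rule LIMSEQ_Suc[OF lim_1_over_n])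
  have "(\<lambda>n. \<integral>\<omega>. g (u n) \<omega> \<partial>\<Omega>) \<longlonglongrightarrow> (\<integral>\<omega>. indicator {\<omega>\<in>space \<Omega>. E \<omega> \<noteq> \<infinity>} \<omega> \<partial>\<Omega>)"
  proof (intro integral_dominated_convergence[where w="\<lambda>_. 1"] AE_I2)
    fix \<omega> assume \<omega>: "\<omega> \<in> space \<Omega>"
    have "(\<lambda>n. (1 + u n * dirichlet_mean P \<omega>) powr - \<theta>) \<longlonglongrightarrow> (1 + 0 * dirichlet_mean P \<omega>) powr - \<theta>"
      using u_lim by (intro tendsto_intros) auto
    then show "(\<lambda>n. g (u n) \<omega>) \<longlonglongrightarrow> indicator {\<omega>\<in>space \<Omega>. E \<omega> \<noteq> \<infinity>} \<omega>"
      using \<omega> by (auto simp: g_def indicator_def)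
    show "norm (g (u n) \<omega>) \<le> 1" for n
      using powr_le_1 u mean_nonneg[OF \<omega>] by (simp add: g_def)
  qed auto
  moreover have "(\<lambda>n. \<integral>\<omega>. g (u n) \<omega> \<partial>\<Omega>) \<longlonglongrightarrow> 1"
  proof -
    have "(\<lambda>n. psi F (u n)) \<longlonglongrightarrow> (\<integral>x. 0 \<partial>F)"
      unfolding psi_def
    proof (rule integral_dominated_convergence[where w="\<lambda>x. ln (1 + 1 * x)"])
      have "(\<lambda>n. ln (1 + u n * x)) \<longlonglongrightarrow> ln (1 + 0 * x)" for x
        using u_lim by (intro tendsto_intros) auto
      then show "AE x in F. (\<lambda>n. ln (1 + u n * x)) \<longlonglongrightarrow> 0" by simp
      show "AE x in F. norm (ln (1 + u n * x)) \<le> ln (1 + 1 * x)" for n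
        using nonneg by eventually_elim (use u[of n] in \<open>auto intro!: ln_le_cancel_iff[THEN iffD2] mult_left_le_one_le add_pos_nonneg\<close>)
    qed (use log_integrable[of 1] in auto)
    then have "(\<lambda>n. exp (- \<theta> * psi F (u n))) \<longlonglongrightarrow> exp (- \<theta> * 0)"
      by (intro tendsto_intros) simp
    then show ?thesis using g_int u by simp
  qed
  ultimately have "\<Omega>.prob {\<omega>\<in>space \<Omega>. E \<omega> \<noteq> \<infinity>} = 1"
    using LIMSEQ_unique by fastforce
  then have fin: "AE \<omega> in \<Omega>. E \<omega> \<noteq> \<infinity>" by (subst (asm) \<Omega>.prob_Collect_eq_1) auto
  show "(\<integral>\<omega>. (1 + z * dirichlet_mean P \<omega>) powr - \<theta> \<partial>\<Omega>) = exp (- \<theta> * psi F z)" if "0 < z" for z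
    unfolding g_int[OF that, symmetric]
    using fin by (intro integral_cong_AE) (auto simp: g_def)
qed

section \<open>Analytic continuation of the Stieltjes identity\<close>

text \<open>Differentiation under the integral sign: a local bound on the derivative bounds the difference
quotients, so that dominated convergence applies to them.\<close>
lemma holomorphic_on_lebesgue_integral:
  fixes f f' :: "complex \<Rightarrow> 'a \<Rightarrow> complex"
  assumes F: "finite_measure F" and S: "open S"
    and deriv: "AE x in F. \<forall>z\<in>S. ((\<lambda>z. f z x) has_field_derivative f' z x) (at z)"
    and bound: "\<And>z. z \<in> S \<Longrightarrow> \<exists>r>0. \<exists>B. ball z r \<subseteq> S \<and> (AE x in F. \<forall>w\<in>ball z r. norm (f' w x) \<le> B)"
    and int: "\<And>z. z \<in> S \<Longrightarrow> integrable F (f z)"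
    and meas: "\<And>z. z \<in> S \<Longrightarrow> f' z \<in> borel_measurable F"
  shows "(\<lambda>z. \<integral>x. f z x \<partial>F) holomorphic_on S"
proof (rule holomorphic_onI)
  fix z assume z: "z \<in> S"
  interpret finite_measure F by fact
  obtain r B where r: "0 < r" "ball z r \<subseteq> S" and B: "AE x in F. \<forall>w\<in>ball z r. norm (f' w x) \<le> B"
    using bound[OF z] by blast
  let ?g = "\<lambda>z. \<integral>x. f z x \<partial>F"
  have "((\<lambda>y. (?g y - ?g z) / (y - z)) \<longlongrightarrow> (\<integral>x. f' z x \<partial>F)) (at z)"
    unfolding tendsto_at_iff_sequentially
  proof (intro allI impI)
    fix Y :: "nat \<Rightarrow> complex" assume Y: "\<forall>i. Y i \<in> UNIV - {z}" "Y \<longlonglongrightarrow> z"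
    have "\<forall>\<^sub>F n in sequentially. Y n \<in> ball z r"
      using Y(2) r(1) by (intro topological_tendstoD[where S="ball z r"]) auto
    then obtain N where N: "\<And>n. n \<ge> N \<Longrightarrow> Y n \<in> ball z r" by (auto simp: eventually_sequentially)
    \<comment> \<open>drop the finitely many terms outside the ball, where no bound on the derivative is available\<close>
    define Z where "Z n = Y (n + N)" for n
    have Z: "Z n \<in> ball z r" "Z n \<noteq> z" "Z n \<in> S" for n
      using N[of "n + N"] Y(1) r(2) by (auto simp: Z_def)
    have Zlim: "Z \<longlonglongrightarrow> z" unfolding Z_def using Y(2) by (rule LIMSEQ_ignore_initial_segment)
    have "(\<lambda>n. \<integral>x. (f (Z n) x - f z x) / (Z n - z) \<partial>F) \<longlonglongrightarrow> (\<integral>x. f' z x \<partial>F)"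
    proof (rule integral_dominated_convergence[where w="\<lambda>_. B"])
      show "f' z \<in> borel_measurable F" using meas z .
      show "(\<lambda>x. (f (Z n) x - f z x) / (Z n - z)) \<in> borel_measurable F" for n
        using borel_measurable_integrable[OF int[OF Z(3)[of n]]] borel_measurable_integrable[OF int[OF z]] by simp
      show "AE x in F. (\<lambda>n. (f (Z n) x - f z x) / (Z n - z)) \<longlonglongrightarrow> f' z x"
        using deriv
      proof eventually_elim
        case (elim x)
        then have "((\<lambda>y. (f y x - f z x) / (y - z)) \<longlongrightarrow> f' z x) (at z)"
          using z by (simp add: has_field_derivative_iff)
        then show ?case
          using Z(2) Zlim unfolding tendsto_at_iff_sequentially by (simp add: comp_def)
      qed
      show "AE x in F. norm ((f (Z n) x - f z x) / (Z n - z)) \<le> B" for n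
        using deriv B
      proof eventually_elim
        case (elim x)
        have "((\<lambda>z. f z x) has_field_derivative f' w x) (at w within ball z r)" if "w \<in> ball z r" for w
          using elim(1) r(2) that by (blast intro: has_field_derivative_at_within)
        then have "norm (f (Z n) x - f z x) \<le> B * norm (Z n - z)"
          using elim(2) r(1) Z(1)[of n]
          by (intro field_differentiable_bound[where S="ball z r" and f'="\<lambda>w. f' w x"]) auto
        then show ?case using Z(2)[of n] by (simp add: norm_divide divide_le_eq)
      qed
    qed simp
    moreover have "(\<integral>x. (f (Z n) x - f z x) / (Z n - z) \<partial>F) = (?g (Z n) - ?g z) / (Z n - z)" for n
      using int Z(3) z by simp
    ultimately have "(\<lambda>n. (?g (Z n) - ?g z) / (Z n - z)) \<longlonglongrightarrow> (\<integral>x. f' z x \<partial>F)"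
      by (simp only:)
    then have "(\<lambda>n. (?g (Y (n + N)) - ?g z) / (Y (n + N) - z)) \<longlonglongrightarrow> (\<integral>x. f' z x \<partial>F)"
      unfolding Z_def .
    then show "((\<lambda>y. (?g y - ?g z) / (y - z)) \<circ> Y) \<longlonglongrightarrow> (\<integral>x. f' z x \<partial>F)"
      unfolding comp_def by (rule LIMSEQ_offset)
  qed
  then have "(?g has_field_derivative (\<integral>x. f' z x \<partial>F)) (at z)"
    by (simp add: has_field_derivative_iff)
  then show "?g field_differentiable at z within S"
    using field_differentiable_at_within field_differentiable_def by blast
qed

abbreviation slit_plane :: "complex set" where
  "slit_plane \<equiv> - \<real>\<^sub>\<le>\<^sub>0"

lemma open_slit_plane: "open slit_plane" by (simp add: open_Compl)

lemma connected_slit_plane: "connected slit_plane"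
proof -
  have "\<real>\<^sub>\<le>\<^sub>0 = complex_of_real ` {..0}" by (auto simp: nonpos_Reals_def)
  then show ?thesis
    using starlike_imp_connected[OF starlike_slotted_complex_plane_left[of 0]] by simp
qed

lemma slit_plane_add: "z \<in> slit_plane \<Longrightarrow> 0 \<le> x \<Longrightarrow> z + complex_of_real x \<in> slit_plane"
  by (auto simp: complex_nonpos_Reals_iff)

text \<open>A disc that avoids the negative half-line keeps its points away from all \<open>- x\<close> with \<open>0 \<le> x\<close>, uniformly in
\<open>x\<close>. This provides the bounds for differentiation under the integral sign.\<close>
lemma slit_plane_dist:
  assumes "z \<in> slit_plane"
  obtains r where "0 < r" "ball z r \<subseteq> slit_plane"
    "\<And>w x. w \<in> ball z r \<Longrightarrow> 0 \<le> x \<Longrightarrow> r \<le> norm (w + complex_of_real x)"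
proof -
  obtain e where e: "0 < e" "ball z e \<subseteq> slit_plane"
    using open_slit_plane assms by (metis open_contains_ball)
  show thesis
  proof (rule that[of "e / 2"])
    show "ball z (e / 2) \<subseteq> slit_plane" using e by (auto simp: subset_eq)
    fix w and x :: real assume w: "w \<in> ball z (e / 2)" and x: "0 \<le> x"
    have "- complex_of_real x \<in> \<real>\<^sub>\<le>\<^sub>0" using x by (simp add: complex_nonpos_Reals_iff)
    then have "- complex_of_real x \<notin> ball z e" using e(2) by blast
    then have "e \<le> dist z (- complex_of_real x)" by simp
    also have "\<dots> \<le> dist z w + dist w (- complex_of_real x)" by (rule dist_triangle)
    finally show "e / 2 \<le> norm (w + complex_of_real x)" using w by (simp add: dist_norm)
  qed (use e in simp)
qed

lemma abs_ln_le:
  fixes r y A x :: real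
  assumes "0 < r" "r \<le> y" "y \<le> A * (1 + x)" "1 \<le> A" "0 \<le> x"
  shows "\<bar>ln y\<bar> \<le> \<bar>ln r\<bar> + ln A + ln (1 + x)"
proof -
  have "ln y \<le> ln (A * (1 + x))" "ln r \<le> ln y" using assms by auto
  moreover have "ln (A * (1 + x)) = ln A + ln (1 + x)" using assms by (simp add: ln_mult)
  moreover have "0 \<le> ln A" "0 \<le> ln (1 + x)" using assms by auto
  ultimately show ?thesis by linarith
qed

lemma integrable_Ln_shift:
  assumes F: "prob_space F" and sF: "sets F = sets borel" and pos: "AE x in F. 0 \<le> x"
    and int: "integrable F (\<lambda>x. ln (1 + x))" and z: "z \<in> slit_plane"
  shows "integrable F (\<lambda>x. Ln (z + complex_of_real x))"
proof -
  interpret prob_space F by fact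
  note [measurable_cong] = sF
  obtain r where r: "0 < r" "\<And>w x. w \<in> ball z r \<Longrightarrow> 0 \<le> x \<Longrightarrow> r \<le> norm (w + complex_of_real x)"
    using slit_plane_dist[OF z] by metis
  show ?thesis
  proof (rule Bochner_Integration.integrable_bound)
    show "integrable F (\<lambda>x. \<bar>ln r\<bar> + ln (1 + norm z) + ln (1 + x) + pi)"
      using int by simp
    show "AE x in F. norm (Ln (z + complex_of_real x)) \<le> norm (\<bar>ln r\<bar> + ln (1 + norm z) + ln (1 + x) + pi)"
      using pos
    proof eventually_elim
      case (elim x)
      have nz: "r \<le> norm (z + complex_of_real x)" using r elim by simp
      then have nz0: "z + complex_of_real x \<noteq> 0" using r(1) by auto
      have "norm (z + complex_of_real x) \<le> norm z + x" using elim by (metis norm_triangle_ineq norm_of_real abs_of_nonneg)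
      also have "\<dots> \<le> (1 + norm z) * (1 + x)" using elim by (simp add: algebra_simps)
      finally have "\<bar>ln (norm (z + complex_of_real x))\<bar> \<le> \<bar>ln r\<bar> + ln (1 + norm z) + ln (1 + x)"
        using nz r(1) elim by (intro abs_ln_le) auto
      moreover have "norm (Ln (z + complex_of_real x)) \<le> \<bar>Re (Ln (z + complex_of_real x))\<bar> + \<bar>Im (Ln (z + complex_of_real x))\<bar>"
        by (rule cmod_le)
      moreover have "\<bar>Im (Ln (z + complex_of_real x))\<bar> \<le> pi"
        using mpi_less_Im_Ln[OF nz0] Im_Ln_le_pi[OF nz0] by simp
      ultimately show ?case using Re_Ln[OF nz0] by simp
    qed
  qed measurable
qed

text \<open>Both sides are holomorphic in the slit plane. They agree at real \<open>z = t > 0\<close>, where the assumption with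
\<open>l = 1 / t\<close> applies after a factor \<open>1 / t\<close> has been taken out, hence they agree everywhere.\<close>
lemma stieltjes_identity_slit_plane:
  assumes \<mu>: "prob_space \<mu>" and s\<mu>: "sets \<mu> = sets borel" and pos\<mu>: "AE x in \<mu>. 0 \<le> x"
    and F: "prob_space F" and sF: "sets F = sets borel" and pos: "AE x in F. 0 \<le> x"
    and int: "\<And>l. 0 < l \<Longrightarrow> integrable F (\<lambda>x. ln (1 + l * x))"
    and eq: "\<And>l. 0 < l \<Longrightarrow> (\<integral>x. 1 / (1 + l * x) \<partial>\<mu>) = exp (- psi F l)"
    and z: "z \<in> slit_plane"
  shows "(\<integral>x. 1 / (z + complex_of_real x) \<partial>\<mu>) = exp (- (\<integral>x. Ln (z + complex_of_real x) \<partial>F))"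
proof -
  interpret \<mu>: prob_space \<mu> by fact
  interpret F: prob_space F by fact
  note [measurable_cong] = sF s\<mu>
  let ?G = "\<lambda>z. (\<integral>x. 1 / (z + complex_of_real x) \<partial>\<mu>)" and ?L = "\<lambda>z. (\<integral>x. Ln (z + complex_of_real x) \<partial>F)"
  have intLn: "integrable F (\<lambda>x. Ln (z + complex_of_real x))" if "z \<in> slit_plane" for z
    using integrable_Ln_shift[OF F sF pos _ that] int[of 1] by simp
  have nz: "z + complex_of_real x \<noteq> 0" if "z \<in> slit_plane" "0 \<le> x" for z x
    using slit_plane_add[OF that] by auto
  have "?L holomorphic_on slit_plane"
  proof (rule holomorphic_on_lebesgue_integral[where f'="\<lambda>z x. 1 / (z + complex_of_real x)"])
    show "AE x in F. \<forall>z\<in>slit_plane. ((\<lambda>z. Ln (z + complex_of_real x)) has_field_derivative 1 / (z + complex_of_real x)) (at z)"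
      using pos
    proof eventually_elim
      case (elim x)
      show ?case
      proof
        fix z assume "z \<in> slit_plane"
        then have "z + complex_of_real x \<notin> \<real>\<^sub>\<le>\<^sub>0" using slit_plane_add elim by blast
        then show "((\<lambda>z. Ln (z + complex_of_real x)) has_field_derivative 1 / (z + complex_of_real x)) (at z)"
          by (auto intro!: derivative_eq_intros simp: divide_inverse)
      qed
    qed
    show "\<exists>r>0. \<exists>B. ball z r \<subseteq> slit_plane \<and> (AE x in F. \<forall>w\<in>ball z r. norm (1 / (w + complex_of_real x)) \<le> B)"
      if z: "z \<in> slit_plane" for z
    proof -
      obtain r where r: "0 < r" "ball z r \<subseteq> slit_plane" "\<And>w x. w \<in> ball z r \<Longrightarrow> 0 \<le> x \<Longrightarrow> r \<le> norm (w + complex_of_real x)"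
        using slit_plane_dist[OF z] by metis
      have "AE x in F. \<forall>w\<in>ball z r. norm (1 / (w + complex_of_real x)) \<le> 1 / r"
        using pos by eventually_elim (use r in \<open>auto simp: norm_divide intro!: frac_le\<close>)
      then show ?thesis using r by blast
    qed
    show "integrable F (\<lambda>x. Ln (z + complex_of_real x))" if "z \<in> slit_plane" for z by (rule intLn[OF that])
    show "(\<lambda>x. 1 / (z + complex_of_real x)) \<in> borel_measurable F" for z by measurable
  qed (rule F.finite_measure_axioms open_slit_plane)+
  moreover have "?G holomorphic_on slit_plane"
  proof (rule holomorphic_on_lebesgue_integral[where f'="\<lambda>z x. - 1 / (z + complex_of_real x)\<^sup>2"])
    show "AE x in \<mu>. \<forall>z\<in>slit_plane. ((\<lambda>z. 1 / (z + complex_of_real x)) has_field_derivative - 1 / (z + complex_of_real x)\<^sup>2) (at z)"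
      using pos\<mu>
    proof eventually_elim
      case (elim x)
      show ?case
      proof
        fix z assume "z \<in> slit_plane"
        then have "z + complex_of_real x \<noteq> 0" using nz elim by blast
        then show "((\<lambda>z. 1 / (z + complex_of_real x)) has_field_derivative - 1 / (z + complex_of_real x)\<^sup>2) (at z)"
          by (auto intro!: derivative_eq_intros simp: power2_eq_square)
      qed
    qed
    show "\<exists>r>0. \<exists>B. ball z r \<subseteq> slit_plane \<and> (AE x in \<mu>. \<forall>w\<in>ball z r. norm (- 1 / (w + complex_of_real x)\<^sup>2) \<le> B)"
      if z: "z \<in> slit_plane" for z
    proof -
      obtain r where r: "0 < r" "ball z r \<subseteq> slit_plane" "\<And>w x. w \<in> ball z r \<Longrightarrow> 0 \<le> x \<Longrightarrow> r \<le> norm (w + complex_of_real x)"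
        using slit_plane_dist[OF z] by metis
      have "norm (- 1 / (w + complex_of_real x)\<^sup>2) \<le> 1 / r\<^sup>2" if "w \<in> ball z r" "0 \<le> x" for w x
      proof -
        have "r\<^sup>2 \<le> (norm (w + complex_of_real x))\<^sup>2" using r(1) r(3)[OF that] by (intro power_mono) auto
        then show ?thesis using r(1) by (simp add: norm_divide norm_power frac_le)
      qed
      then have "AE x in \<mu>. \<forall>w\<in>ball z r. norm (- 1 / (w + complex_of_real x)\<^sup>2) \<le> 1 / r\<^sup>2"
        using pos\<mu> by auto
      then show ?thesis using r by blast
    qed
    show "integrable \<mu> (\<lambda>x. 1 / (z + complex_of_real x))" if z: "z \<in> slit_plane" for z
    proof -
      obtain r where r: "0 < r" "ball z r \<subseteq> slit_plane" "\<And>w x. w \<in> ball z r \<Longrightarrow> 0 \<le> x \<Longrightarrow> r \<le> norm (w + complex_of_real x)"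
        using slit_plane_dist[OF z] by metis
      have "AE x in \<mu>. norm (1 / (z + complex_of_real x)) \<le> 1 / r"
        using pos\<mu> by eventually_elim (use r in \<open>auto simp: norm_divide intro!: frac_le\<close>)
      then show ?thesis by (rule \<mu>.integrable_const_bound) measurable
    qed
    show "(\<lambda>x. - 1 / (z + complex_of_real x)\<^sup>2) \<in> borel_measurable \<mu>" for z by measurable
  qed (rule \<mu>.finite_measure_axioms open_slit_plane)+
  ultimately have hol: "(\<lambda>z. ?G z - exp (- ?L z)) holomorphic_on slit_plane"
    by (intro holomorphic_intros)
  have real: "?G (complex_of_real t) - exp (- ?L (complex_of_real t)) = 0" if t: "0 < t" for t
  proof -
    have "?G (complex_of_real t) = complex_of_real (\<integral>x. 1 / (t + x) \<partial>\<mu>)"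
      by (simp flip: integral_complex_of_real)
    also have "(\<integral>x. 1 / (t + x) \<partial>\<mu>) = (\<integral>x. (1 / t) * (1 / (1 + 1 / t * x)) \<partial>\<mu>)"
      using t by (intro Bochner_Integration.integral_cong) (auto simp: field_simps)
    also have "\<dots> = (1 / t) * exp (- psi F (1 / t))"
      using t eq[of "1 / t"] by (subst integral_mult_right_zero) simp
    also have "\<dots> = exp (- (ln t + psi F (1 / t)))" using t by (simp add: exp_add exp_minus exp_diff field_simps)
    also have "ln t + psi F (1 / t) = (\<integral>x. ln t + ln (1 + 1 / t * x) \<partial>F)"
      unfolding psi_def using t int[of "1 / t"] by (subst Bochner_Integration.integral_add) (auto simp: F.prob_space)
    also have "\<dots> = (\<integral>x. ln (t + x) \<partial>F)"
    proof (rule integral_cong_AE)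
      show "AE x in F. ln t + ln (1 + 1 / t * x) = ln (t + x)"
        using pos
      proof eventually_elim
        case (elim x)
        have "0 < 1 + 1 / t * x" using t elim by (intro add_pos_nonneg) auto
        then have "ln t + ln (1 + 1 / t * x) = ln (t * (1 + 1 / t * x))" using t by (simp add: ln_mult_pos)
        also have "t * (1 + 1 / t * x) = t + x" using t by (simp add: field_simps)
        finally show ?case .
      qed
    qed auto
    also have "complex_of_real (exp (- (\<integral>x. ln (t + x) \<partial>F))) = exp (- ?L (complex_of_real t))"
    proof -
      have "?L (complex_of_real t) = (\<integral>x. complex_of_real (ln (t + x)) \<partial>F)"
      proof (rule integral_cong_AE)
        show "AE x in F. Ln (complex_of_real t + complex_of_real x) = complex_of_real (ln (t + x))"
          using pos by eventually_elim (use t in \<open>simp add: Ln_of_real flip: of_real_add\<close>)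
      qed auto
      then show ?thesis by (simp add: exp_of_real[symmetric])
    qed
    finally show ?thesis by simp
  qed
  have "?G z - exp (- ?L z) = 0"
  proof (rule analytic_continuation[OF hol open_slit_plane connected_slit_plane])
    show "complex_of_real ` {0<..} \<subseteq> slit_plane" by (auto simp: complex_nonpos_Reals_iff)
    show "complex_of_real 1 \<in> slit_plane" by (auto simp: complex_nonpos_Reals_iff)
    show "complex_of_real 1 islimpt complex_of_real ` {0<..}"
      unfolding islimpt_sequential
    proof (intro exI[of _ "\<lambda>n. complex_of_real (1 + 1 / real (Suc n))"] conjI allI)
      show "complex_of_real (1 + 1 / real (Suc n)) \<in> complex_of_real ` {0<..} - {complex_of_real 1}" for n
        by (auto simp: add_pos_nonneg simp del: of_real_add of_real_1)
      show "(\<lambda>n. complex_of_real (1 + 1 / real (Suc n))) \<longlonglongrightarrow> complex_of_real 1"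
        by (rule tendsto_of_real) (use tendsto_add[OF tendsto_const LIMSEQ_Suc[OF lim_1_over_n], of 1] in simp)
    qed
    show "?G w - exp (- ?L w) = 0" if "w \<in> complex_of_real ` {0<..}" for w using that real by auto
  qed (use z in auto)
  then show ?thesis by simp
qed

section \<open>Boundary values of the Stieltjes transform\<close>

text \<open>Up to the factor \<open>- 1 / pi\<close>, this is the limit of the imaginary part of \<open>exp (- \<integral>t. Ln (z + t) \<partial>F)\<close> as \<open>z\<close>
approaches \<open>- x\<close> from the upper half-plane.\<close>
definition mean_density :: "real measure \<Rightarrow> real \<Rightarrow> real" where
  "mean_density F x = sin (pi * cdf F x) * exp (- Phi F x) / pi"

text \<open>A law \<open>\<mu>\<close> related to \<open>F\<close> in the way in which the mean of a Dirichlet process of total mass 1 is related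
to its parameter. The last assumption makes \<open>\<mu>\<close> absolutely continuous: for a point mass \<open>F\<close>, the
identity holds with \<open>\<mu> = F\<close>.\<close>
locale stieltjes_pair = half_line_prob F + \<mu>: prob_space \<mu> for F \<mu> :: "real measure" +
  assumes sets_\<mu> [simp, measurable_cong]: "sets \<mu> = sets borel"
    and nonneg_\<mu>: "AE m in \<mu>. 0 \<le> m"
    and stieltjes_eq: "\<And>l. 0 < l \<Longrightarrow> (\<integral>m. 1 / (1 + l * m) \<partial>\<mu>) = exp (- psi F l)"
    and no_unit_atom: "\<And>x. measure F {x} \<noteq> 1"
begin

lemma space_\<mu> [simp]: "space \<mu> = UNIV"
  using sets_eq_imp_space_eq[OF sets_\<mu>] by simp

definition log_transform :: "real \<Rightarrow> real \<Rightarrow> complex" where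
  "log_transform \<epsilon> x = (\<integral>t. Ln (Complex (t - x) \<epsilon>) \<partial>F)"

definition poisson :: "real \<Rightarrow> real \<Rightarrow> real" where
  "poisson \<epsilon> x = (\<integral>m. \<epsilon> / ((x - m)\<^sup>2 + \<epsilon>\<^sup>2) \<partial>\<mu>)"

lemma borel_measurable_mean_density [measurable]: "mean_density F \<in> borel_measurable borel"
  unfolding mean_density_def by measurable

lemma mean_density_nonneg: "0 \<le> mean_density F x"
  unfolding mean_density_def cdf_def
  by (intro divide_nonneg_pos mult_nonneg_nonneg sin_ge_zero) (auto simp: mult_left_le)

lemma shift_in_slit_plane: "0 < \<epsilon> \<Longrightarrow> Complex (- x) \<epsilon> \<in> slit_plane"
  by (auto simp: complex_nonpos_Reals_iff)

lemma Complex_shift: "Complex (- x) \<epsilon> + complex_of_real t = Complex (t - x) \<epsilon>"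
  by (simp add: complex_eq_iff)

lemma integrable_log_transform:
  assumes "0 < \<epsilon>" shows "integrable F (\<lambda>t. Ln (Complex (t - x) \<epsilon>))"
  using integrable_Ln_shift[OF prob_space_axioms sets_F nonneg _ shift_in_slit_plane[OF assms, of x]] log_integrable[of 1]
  by (simp add: Complex_shift)

lemma integrable_poisson_kernel:
  assumes "0 < \<epsilon>" shows "integrable \<mu> (\<lambda>m. \<epsilon> / ((x - m)\<^sup>2 + \<epsilon>\<^sup>2))"
proof (rule \<mu>.integrable_const_bound)
  show "AE m in \<mu>. norm (\<epsilon> / ((x - m)\<^sup>2 + \<epsilon>\<^sup>2)) \<le> \<epsilon> / \<epsilon>\<^sup>2"
    using assms by (intro AE_I2) (auto intro!: divide_left_mono mult_pos_pos add_nonneg_pos)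
qed measurable

lemma poisson_eq:
  assumes "0 < \<epsilon>" shows "poisson \<epsilon> x = - Im (exp (- log_transform \<epsilon> x))"
proof -
  have eq: "(\<integral>m. 1 / Complex (m - x) \<epsilon> \<partial>\<mu>) = exp (- log_transform \<epsilon> x)"
    using stieltjes_identity_slit_plane[OF \<mu>.prob_space_axioms sets_\<mu> nonneg_\<mu> prob_space_axioms sets_F nonneg
        log_integrable stieltjes_eq shift_in_slit_plane[OF assms, of x]]
    by (simp add: Complex_shift log_transform_def)
  have Im: "Im (1 / Complex (m - x) \<epsilon>) = - (\<epsilon> / ((x - m)\<^sup>2 + \<epsilon>\<^sup>2))" for m
    by (simp add: Im_divide power2_commute)
  have "integrable \<mu> (\<lambda>m. 1 / Complex (m - x) \<epsilon>)"
  proof (rule \<mu>.integrable_const_bound)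
    have "\<epsilon> \<le> norm (Complex (m - x) \<epsilon>)" for m
      using abs_Im_le_cmod[of "Complex (m - x) \<epsilon>"] by simp
    then show "AE m in \<mu>. norm (1 / Complex (m - x) \<epsilon>) \<le> 1 / \<epsilon>"
      using assms by (intro AE_I2) (auto simp: norm_divide intro!: frac_le)
    have "(\<lambda>m. 1 / (Complex (- x) \<epsilon> + complex_of_real m)) \<in> borel_measurable \<mu>" by measurable
    then show "(\<lambda>m. 1 / Complex (m - x) \<epsilon>) \<in> borel_measurable \<mu>" by (simp add: Complex_shift)
  qed
  then have "Im (exp (- log_transform \<epsilon> x)) = (\<integral>m. Im (1 / Complex (m - x) \<epsilon>) \<partial>\<mu>)"
    unfolding eq[symmetric] by (rule integral_Im[symmetric])
  then show ?thesis unfolding Im poisson_def by simp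
qed

text \<open>On the negative half-line the principal logarithm is the limit from above. A rotation by a right
angle moves the point to the imaginary axis, where the logarithm is continuous.\<close>
lemma Ln_Complex_tendsto:
  assumes y: "y \<noteq> 0" and e: "e \<longlonglongrightarrow> 0" "\<And>n. 0 < e n"
  shows "(\<lambda>n. Ln (Complex y (e n))) \<longlonglongrightarrow> Ln (complex_of_real y)"
proof -
  have *: "Ln (Complex y s) = Ln (Complex s (- y)) + \<i> * of_real pi / 2" if "0 \<le> s" for s
  proof -
    have "Complex y s = \<i> * Complex s (- y)" by (simp add: complex_eq_iff)
    moreover have "Complex s (- y) \<noteq> 0" using y by (simp add: complex_eq_iff)
    ultimately show ?thesis using that by (simp add: Ln_times_ii)
  qed
  have "(\<lambda>n. Complex (e n) (- y)) \<longlonglongrightarrow> Complex 0 (- y)" using e(1) by (intro tendsto_intros)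
  then have "(\<lambda>n. Ln (Complex (e n) (- y)) + \<i> * of_real pi / 2) \<longlonglongrightarrow> Ln (Complex 0 (- y)) + \<i> * of_real pi / 2"
    using y by (intro tendsto_add tendsto_Ln tendsto_const) (auto simp: complex_nonpos_Reals_iff)
  moreover have "Ln (complex_of_real y) = Ln (Complex 0 (- y)) + \<i> * of_real pi / 2"
    using *[of 0] by (simp add: complex_of_real_def)
  ultimately show ?thesis using * e(2) by (simp add: less_imp_le)
qed

text \<open>The real part of the logarithm contributes the potential \<open>Phi F\<close>; the imaginary part is \<open>pi\<close> to the left
of \<open>x\<close> and 0 to the right, and contributes the distribution function.\<close>
lemma log_transform_tendsto:
  assumes int: "integrable F (\<lambda>t. ln \<bar>x - t\<bar>)" and atom: "measure F {x} = 0"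
    and e: "e \<longlonglongrightarrow> 0" "\<And>n. 0 < e n" "\<And>n. e n \<le> 1"
  shows "(\<lambda>n. log_transform (e n) x) \<longlonglongrightarrow> Complex (Phi F x) (pi * cdf F x)"
proof -
  have neq: "AE t in F. t \<noteq> x" by (rule AE_neq_of_no_atom[OF atom])
  let ?w = "\<lambda>t. \<bar>ln \<bar>x - t\<bar>\<bar> + (ln (2 + \<bar>x\<bar>) + ln (1 + t)) + pi"
  let ?L = "\<lambda>t. Ln (complex_of_real (t - x))"
  have w: "integrable F ?w" using int log_integrable[of 1] by simp
  have mL: "?L \<in> borel_measurable F" by measurable
  have mE: "(\<lambda>t. Ln (Complex (t - x) (e n))) \<in> borel_measurable F" for n
    using integrable_log_transform[OF e(2)] by (rule borel_measurable_integrable)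
  have lim: "AE t in F. (\<lambda>n. Ln (Complex (t - x) (e n))) \<longlonglongrightarrow> ?L t"
    using neq by eventually_elim (rule Ln_Complex_tendsto, use e in auto)
  have bound: "AE t in F. norm (Ln (Complex (t - x) (e n))) \<le> ?w t" for n
    using neq nonneg
  proof eventually_elim
    case (elim t)
    let ?z = "Complex (t - x) (e n)"
    have nz: "?z \<noteq> 0" using elim by (simp add: complex_eq_iff)
    have l: "\<bar>x - t\<bar> \<le> norm ?z" using abs_Re_le_cmod[of ?z] by simp
    have "norm ?z \<le> \<bar>t - x\<bar> + \<bar>e n\<bar>" using cmod_le[of ?z] by simp
    also have "\<dots> \<le> 1 + \<bar>x\<bar> + t" using e(2,3)[of n] elim by linarith
    also have "\<dots> \<le> (2 + \<bar>x\<bar>) * (1 + t)" using elim by (simp add: algebra_simps)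
    finally have u: "norm ?z \<le> (2 + \<bar>x\<bar>) * (1 + t)" .
    have "\<bar>ln (norm ?z)\<bar> \<le> \<bar>ln \<bar>x - t\<bar>\<bar> + ln (2 + \<bar>x\<bar>) + ln (1 + t)"
      using elim l u by (intro abs_ln_le) auto
    moreover have "norm (Ln ?z) \<le> \<bar>Re (Ln ?z)\<bar> + \<bar>Im (Ln ?z)\<bar>" by (rule cmod_le)
    moreover have "\<bar>Im (Ln ?z)\<bar> \<le> pi" using mpi_less_Im_Ln[OF nz] Im_Ln_le_pi[OF nz] by simp
    ultimately show ?case using Re_Ln[OF nz] by simp
  qed
  have "(\<lambda>n. log_transform (e n) x) \<longlonglongrightarrow> (\<integral>t. ?L t \<partial>F)"
    unfolding log_transform_def by (rule integral_dominated_convergence[OF mL mE w lim bound])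
  moreover have L: "integrable F ?L"
    by (rule integrable_dominated_convergence[OF mL mE w lim bound])
  have "Re (\<integral>t. ?L t \<partial>F) = Phi F x"
  proof -
    have "Re (\<integral>t. ?L t \<partial>F) = (\<integral>t. Re (?L t) \<partial>F)" by (rule integral_Re[symmetric, OF L])
    also have "\<dots> = (\<integral>t. ln \<bar>x - t\<bar> \<partial>F)"
    proof (rule integral_cong_AE)
      show "AE t in F. Re (?L t) = ln \<bar>x - t\<bar>"
        using neq by eventually_elim (simp add: Re_Ln abs_minus_commute del: of_real_diff)
    qed measurable
    finally show ?thesis by (simp add: Phi_eq)
  qed
  moreover have "Im (\<integral>t. ?L t \<partial>F) = pi * cdf F x"
  proof -
    have "Im (\<integral>t. ?L t \<partial>F) = (\<integral>t. Im (?L t) \<partial>F)" by (rule integral_Im[symmetric, OF L])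
    also have "\<dots> = (\<integral>t. pi * indicator {..x} t \<partial>F)"
    proof (rule integral_cong_AE)
      show "AE t in F. Im (?L t) = pi * indicator {..x} t"
        using neq
      proof eventually_elim
        case (elim t)
        then show ?case
          using Im_Ln_pos_le[of "complex_of_real (t - x)"] Im_Ln_eq_pi[of "complex_of_real (t - x)"]
            Im_Ln_eq_0[of "complex_of_real (t - x)"]
          by (cases "t < x") (auto simp: indicator_def)
      qed
    qed measurable
    finally show ?thesis by (simp add: cdf_def)
  qed
  ultimately show ?thesis by (metis complex_surj)
qed

lemma poisson_tendsto:
  assumes int: "integrable F (\<lambda>t. ln \<bar>x - t\<bar>)" and atom: "measure F {x} = 0"
    and e: "e \<longlonglongrightarrow> 0" "\<And>n. 0 < e n" "\<And>n. e n \<le> 1"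
  shows "(\<lambda>n. poisson (e n) x / pi) \<longlonglongrightarrow> mean_density F x"
proof -
  have "(\<lambda>n. - Im (exp (- log_transform (e n) x)) / pi) \<longlonglongrightarrow> - Im (exp (- Complex (Phi F x) (pi * cdf F x))) / pi"
    by (intro tendsto_intros log_transform_tendsto[OF int atom e]) auto
  then show ?thesis using e(2) by (simp add: poisson_eq mean_density_def Im_exp mult_ac)
qed

end

section \<open>Stieltjes inversion\<close>
lemma tendsto_arctan_scaled:
  assumes e: "e \<longlonglongrightarrow> 0" "\<And>n::nat. 0 < e n"
  shows "(\<lambda>n. arctan (y / e n)) \<longlonglongrightarrow> pi / 2 * sgn y"
proof -
  have inv: "filterlim (\<lambda>n. inverse (e n)) at_top sequentially"
    using e by (intro filterlim_inverse_at_top) auto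
  have pos: "(\<lambda>n. arctan (c / e n)) \<longlonglongrightarrow> pi / 2" if "0 < c" for c
  proof -
    have "filterlim (\<lambda>n. c * inverse (e n)) at_top sequentially"
      by (rule filterlim_tendsto_pos_mult_at_top[OF tendsto_const that inv])
    then have "filterlim (\<lambda>n. c / e n) at_top sequentially" by (simp add: divide_inverse)
    then show ?thesis by (rule filterlim_compose[OF tendsto_arctan_at_top])
  qed
  consider "y = 0" | "0 < y" | "y < 0" by linarith
  then show ?thesis
  proof cases
    case 3
    then have "(\<lambda>n. - arctan (- y / e n)) \<longlonglongrightarrow> - (pi / 2)" by (intro tendsto_minus pos) simp
    then show ?thesis using 3 by (simp add: arctan_minus)
  qed (use pos in auto)
qed

lemma nn_integral_poisson_kernel:
  assumes "a \<le> b" "0 < \<epsilon>"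
  shows "(\<integral>\<^sup>+x. ennreal (\<epsilon> / ((x - m)\<^sup>2 + \<epsilon>\<^sup>2)) * indicator {a..b} x \<partial>lborel)
       = ennreal (arctan ((b - m) / \<epsilon>) - arctan ((a - m) / \<epsilon>))"
proof (rule nn_integral_FTC_Icc)
  fix x
  have "\<epsilon>\<^sup>2 + (x - m)\<^sup>2 \<noteq> 0" using assms by (simp add: sum_power2_eq_zero_iff)
  then show "((\<lambda>x. arctan ((x - m) / \<epsilon>)) has_real_derivative \<epsilon> / ((x - m)\<^sup>2 + \<epsilon>\<^sup>2)) (at x)"
    using assms by (auto intro!: derivative_eq_intros simp: field_simps power2_eq_square)
qed (use assms in auto)

context half_line_prob
begin

text \<open>The balls shrink to a point that does not carry the whole mass. The bound \<open>\<delta> \<le> 1/3\<close> keeps the distance from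
points of the ball of radius \<open>\<delta>\<close> to points of the ball of radius \<open>2 * \<delta>\<close> within the cut-off of the
Riesz kernel.\<close>
lemma small_ball_not_full:
  assumes "measure F {x} \<noteq> 1"
  obtains \<delta> where "0 < \<delta>" "\<delta> \<le> 1/3" "measure F {x - 2 * \<delta>..x + 2 * \<delta>} < 1"
proof -
  define A where "A n = {x - 2 * (1 / (3 * real (Suc n)))..x + 2 * (1 / (3 * real (Suc n)))}" for n
  have lim0: "(\<lambda>n. 2 * (1 / (3 * real (Suc n)))) \<longlonglongrightarrow> 0"
    using tendsto_mult_right[OF LIMSEQ_Suc[OF lim_1_over_n], of "2/3"] by (simp add: field_simps)
  have dec: "decseq A"
  proof (rule decseq_SucI)
    fix n
    have "1 / (3 * real (Suc (Suc n))) \<le> 1 / (3 * real (Suc n))" by (intro frac_le) auto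
    then show "A (Suc n) \<subseteq> A n" unfolding A_def by (intro subsetI) auto
  qed
  have Int: "(\<Inter>n. A n) = {x}"
  proof safe
    fix y assume y: "y \<in> (\<Inter>n. A n)"
    have "(\<lambda>n. x - 2 * (1 / (3 * real (Suc n)))) \<longlonglongrightarrow> x - 0" "(\<lambda>n. x + 2 * (1 / (3 * real (Suc n)))) \<longlonglongrightarrow> x + 0"
      by (intro tendsto_intros lim0)+
    moreover have "x - 2 * (1 / (3 * real (Suc n))) \<le> y" "y \<le> x + 2 * (1 / (3 * real (Suc n)))" for n
      using y by (auto simp: A_def simp del: of_nat_Suc)
    ultimately have "x - 0 \<le> y" "y \<le> x + 0"
      by (auto intro: LIMSEQ_le_const2 LIMSEQ_le_const)
    then show "y = x" by simp
  qed (auto simp: A_def)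
  have "(\<lambda>n. measure F (A n)) \<longlonglongrightarrow> measure F (\<Inter>n. A n)"
    by (rule finite_Lim_measure_decseq[OF _ dec]) (auto simp: A_def)
  moreover have "measure F {x} < 1" using assms prob_le_1[of "{x}"] by (simp add: less_le)
  ultimately have "\<forall>\<^sub>F n in sequentially. measure F (A n) < 1"
    unfolding Int by (rule order_tendstoD)
  then obtain n where "measure F (A n) < 1" by (auto simp: eventually_sequentially)
  then show thesis
    by (intro that[of "1 / (3 * real (Suc n))"]) (auto simp: A_def simp del: of_nat_Suc)
qed

end

context stieltjes_pair
begin

text \<open>The bound that rules out a singular part. The far part of \<open>F\<close> contributes at most the factor
\<open>1 / \<delta>\<close> to \<open>exp (- \<integral>t. ln \<bar>x - t\<bar> \<partial>F)\<close>. For the near part, of mass \<open>q\<close>, Jensen's inequality for the normalised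
measure gives the average of \<open>\<bar>x - t\<bar> powr - q\<close> instead of the average of \<open>1 / \<bar>x - t\<bar>\<close>, and since \<open>q < 1\<close>
this is locally integrable in \<open>x\<close>. The bound is uniform in \<open>\<epsilon>\<close>.\<close>
lemma exp_log_potential_bound:
  assumes \<delta>: "0 < \<delta>" "\<delta> \<le> 1/3" and x: "\<bar>x - x0\<bar> \<le> \<delta>" and \<epsilon>: "0 < \<epsilon>"
    and atom: "measure F {x} = 0"
    and q: "q = measure F {x0 - 2 * \<delta>..x0 + 2 * \<delta>}"
    and fin: "riesz_potential q x < \<infinity>"
  shows "norm (exp (- log_transform \<epsilon> x)) \<le> (1 + enn2real (riesz_potential q x) / q) / \<delta>"
proof -
  let ?near = "{x0 - 2 * \<delta>..x0 + 2 * \<delta>}"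
  define L where "L t = ln (norm (Complex (t - x) \<epsilon>))" for t
  have nz: "Complex (t - x) \<epsilon> \<noteq> 0" for t using \<epsilon> by (simp add: complex_eq_iff)
  have q0: "0 \<le> q" by (simp add: q)
  have neq: "AE t in F. t \<noteq> x" by (rule AE_neq_of_no_atom[OF atom])
  have LRe: "L t = Re (Ln (Complex (t - x) \<epsilon>))" for t using Re_Ln[OF nz[of t]] by (simp add: L_def)
  have L: "integrable F L" unfolding LRe[abs_def] by (intro integrable_Re integrable_log_transform \<epsilon>)
  have [measurable]: "L \<in> borel_measurable borel" using borel_measurable_integrable[OF L] by simp
  have L_near: "integrable F (\<lambda>t. indicator ?near t * L t)" and L_far: "integrable F (\<lambda>t. indicator (- ?near) t * L t)"
    by (rule Bochner_Integration.integrable_bound[OF L]; auto simp: indicator_def)+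
  have L_ge: "ln \<bar>t - x\<bar> \<le> L t" if "t \<noteq> x" for t
    unfolding L_def using that abs_Re_le_cmod[of "Complex (t - x) \<epsilon>"] nz[of t]
    by (intro ln_le_cancel_iff[THEN iffD2]) auto
  define J where "J = - (\<integral>t. indicator ?near t * L t \<partial>F)"
  have near: "exp J \<le> 1 + enn2real (riesz_potential q x) / q"
  \<comment> \<open>for \<open>q = 0\<close> the near part is negligible, and the quotient by \<open>q\<close> in the bound is 0\<close>
  proof (cases "q = 0")
    case True
    then have "AE t in F. t \<notin> ?near"
      unfolding q by (intro AE_I[where N="?near"]) (auto simp: emeasure_eq_measure)
    then have "AE t in F. indicator ?near t * L t = 0" by eventually_elim simp
    then have "J = 0" unfolding J_def by (simp add: integral_eq_zero_AE)
    then show ?thesis using True by simp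
  next
    case False
    with q0 have q0: "0 < q" by simp
    have i1: "integrable F (\<lambda>t. indicator ?near t * (exp J * (1 - J)))"
      and i2: "integrable F (\<lambda>t. exp J * q * (indicator ?near t * L t))"
      using L_near by (auto simp: less_top[symmetric])
    have "q * exp J = (\<integral>t. indicator ?near t * (exp J * (1 - J)) \<partial>F) - (\<integral>t. exp J * q * (indicator ?near t * L t) \<partial>F)"
    proof -
      have "(\<integral>t. indicator ?near t * (exp J * (1 - J)) \<partial>F) = q * (exp J * (1 - J))" by (simp add: q)
      moreover have "(\<integral>t. exp J * q * (indicator ?near t * L t) \<partial>F) = exp J * q * - J"
        unfolding J_def minus_minus by (rule integral_mult_right_zero)
      ultimately show ?thesis by (simp add: algebra_simps)
    qed
    also have "\<dots> = (\<integral>t. indicator ?near t * (exp J * (1 - J)) - exp J * q * (indicator ?near t * L t) \<partial>F)"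
      by (rule Bochner_Integration.integral_diff[symmetric, OF i1 i2])
    also have "\<dots> \<le> (\<integral>t. riesz_kernel q (x - t) \<partial>F)"
    proof (rule integral_mono_AE)
      show "integrable F (\<lambda>t. indicator ?near t * (exp J * (1 - J)) - exp J * q * (indicator ?near t * L t))"
        by (rule Bochner_Integration.integrable_diff[OF i1 i2])
      show "integrable F (\<lambda>t. riesz_kernel q (x - t))" using fin by (rule integrable_riesz_kernel)
      show "AE t in F. indicator ?near t * (exp J * (1 - J)) - exp J * q * (indicator ?near t * L t) \<le> riesz_kernel q (x - t)"
        using neq
      proof eventually_elim
        case (elim t)
        show ?case
        proof (cases "t \<in> ?near")
          case True
          then have "\<bar>x - t\<bar> \<le> 1" using x \<delta> by (auto simp: abs_le_iff)
          then have "riesz_kernel q (x - t) = exp (- q * ln \<bar>t - x\<bar>)"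
            using elim by (simp add: riesz_kernel_def powr_def abs_minus_commute)
          \<comment> \<open>Jensen's inequality in its tangent form: \<open>exp\<close> lies above its tangent at \<open>J\<close>\<close>
          moreover have "exp J * (1 + (- q * ln \<bar>t - x\<bar> - J)) \<le> exp J * exp (- q * ln \<bar>t - x\<bar> - J)"
            by (intro mult_left_mono exp_ge_add_one_self) simp
          moreover have "\<dots> = exp (- q * ln \<bar>t - x\<bar>)" by (simp flip: exp_add)
          moreover have "exp J * (q * ln \<bar>t - x\<bar>) \<le> exp J * (q * L t)"
            using L_ge[OF elim] q0 by (intro mult_left_mono) auto
          ultimately show ?thesis using True by (simp add: algebra_simps)
        qed (simp add: riesz_kernel_nonneg)
      qed
    qed
    also have "\<dots> = enn2real (riesz_potential q x)"
      unfolding riesz_potential_def by (intro integral_eq_nn_integral) (auto simp: riesz_kernel_nonneg)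
    finally have "exp J \<le> enn2real (riesz_potential q x) / q" using q0 by (simp add: field_simps)
    then show ?thesis by simp
  qed
  \<comment> \<open>far points have distance at least \<open>\<delta>\<close> from \<open>x\<close>, and since \<open>ln \<delta> \<le> 0\<close> their total mass does not matter\<close>
  have far: "ln \<delta> \<le> (\<integral>t. indicator (- ?near) t * L t \<partial>F)"
  proof -
    have "ln \<delta> = (\<integral>t. ln \<delta> \<partial>F)" using prob_space by simp
    also have "\<dots> \<le> (\<integral>t. indicator (- ?near) t * L t \<partial>F)"
    proof (rule integral_mono_AE)
      show "AE t in F. ln \<delta> \<le> indicator (- ?near) t * L t"
        using neq
      proof eventually_elim
        case (elim t)
        show ?case
        proof (cases "t \<in> ?near")
          case False
          then have "\<delta> \<le> \<bar>t - x\<bar>" using x \<delta> by (auto simp: abs_le_iff abs_if split: if_splits)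
          then have "ln \<delta> \<le> ln \<bar>t - x\<bar>" using \<delta> by auto
          then show ?thesis using False L_ge[OF elim] by simp
        qed (use \<delta> in simp)
      qed
    qed (use L_far in auto)
    finally show ?thesis .
  qed
  have "Re (log_transform \<epsilon> x) = (\<integral>t. L t \<partial>F)"
    unfolding log_transform_def LRe using integral_Re[OF integrable_log_transform[OF \<epsilon>]] by simp
  also have "\<dots> = (\<integral>t. indicator ?near t * L t + indicator (- ?near) t * L t \<partial>F)"
    by (intro Bochner_Integration.integral_cong) (auto simp: indicator_def)
  also have "\<dots> = - J + (\<integral>t. indicator (- ?near) t * L t \<partial>F)"
    using L_near L_far by (subst Bochner_Integration.integral_add) (auto simp: J_def)
  finally have "norm (exp (- log_transform \<epsilon> x)) = exp J * exp (- (\<integral>t. indicator (- ?near) t * L t \<partial>F))"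
    by (simp flip: exp_add)
  also have "\<dots> \<le> (1 + enn2real (riesz_potential q x) / q) * (1 / \<delta>)"
  proof (intro mult_mono near)
    have "exp (- (\<integral>t. indicator (- ?near) t * L t \<partial>F)) \<le> exp (- ln \<delta>)" using far by simp
    then show "exp (- (\<integral>t. indicator (- ?near) t * L t \<partial>F)) \<le> 1 / \<delta>" using \<delta> by (simp add: exp_minus inverse_eq_divide)
  qed (use q0 in auto)
  finally show ?thesis by simp
qed

lemma borel_measurable_poisson [measurable]: "poisson \<epsilon> \<in> borel_measurable borel"
  unfolding poisson_def by measurable

lemma poisson_nonneg: "0 < \<epsilon> \<Longrightarrow> 0 \<le> poisson \<epsilon> x"
  unfolding poisson_def by (intro Bochner_Integration.integral_nonneg) simp

lemma nn_integral_poisson_Icc: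
  assumes "a \<le> b" and \<epsilon>: "0 < \<epsilon>"
  shows "(\<integral>\<^sup>+x. ennreal (poisson \<epsilon> x) * indicator {a..b} x \<partial>lborel)
       = ennreal (\<integral>m. arctan ((b - m) / \<epsilon>) - arctan ((a - m) / \<epsilon>) \<partial>\<mu>)"
proof -
  interpret P: pair_sigma_finite lborel \<mu> by unfold_locales
  have "ennreal (poisson \<epsilon> x) = (\<integral>\<^sup>+m. ennreal (\<epsilon> / ((x - m)\<^sup>2 + \<epsilon>\<^sup>2)) \<partial>\<mu>)" for x
    unfolding poisson_def using \<epsilon> by (intro nn_integral_eq_integral[symmetric] integrable_poisson_kernel) auto
  then have "(\<integral>\<^sup>+x. ennreal (poisson \<epsilon> x) * indicator {a..b} x \<partial>lborel)
      = (\<integral>\<^sup>+x. \<integral>\<^sup>+m. ennreal (\<epsilon> / ((x - m)\<^sup>2 + \<epsilon>\<^sup>2)) * indicator {a..b} x \<partial>\<mu> \<partial>lborel)"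
    by (simp add: nn_integral_multc)
  also have "\<dots> = (\<integral>\<^sup>+m. \<integral>\<^sup>+x. ennreal (\<epsilon> / ((x - m)\<^sup>2 + \<epsilon>\<^sup>2)) * indicator {a..b} x \<partial>lborel \<partial>\<mu>)"
    by (rule P.Fubini'[symmetric]) measurable
  also have "\<dots> = (\<integral>\<^sup>+m. ennreal (arctan ((b - m) / \<epsilon>) - arctan ((a - m) / \<epsilon>)) \<partial>\<mu>)"
    using assms by (simp add: nn_integral_poisson_kernel)
  also have "\<dots> = ennreal (\<integral>m. arctan ((b - m) / \<epsilon>) - arctan ((a - m) / \<epsilon>) \<partial>\<mu>)"
  proof (rule nn_integral_eq_integral)
    show "integrable \<mu> (\<lambda>m. arctan ((b - m) / \<epsilon>) - arctan ((a - m) / \<epsilon>))"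
    proof (rule \<mu>.integrable_const_bound)
      show "AE m in \<mu>. norm (arctan ((b - m) / \<epsilon>) - arctan ((a - m) / \<epsilon>)) \<le> pi"
      proof (intro AE_I2)
        fix m
        show "norm (arctan ((b - m) / \<epsilon>) - arctan ((a - m) / \<epsilon>)) \<le> pi"
          using arctan_bounded[of "(b - m) / \<epsilon>"] arctan_bounded[of "(a - m) / \<epsilon>"] by (simp add: abs_le_iff)
      qed
    qed measurable
    show "AE m in \<mu>. 0 \<le> arctan ((b - m) / \<epsilon>) - arctan ((a - m) / \<epsilon>)"
      using assms by (intro AE_I2) (simp add: arctan_le_iff divide_right_mono)
  qed
  finally show ?thesis .
qed

text \<open>The limit of the arctangents gives weight one half to the end points of the interval.\<close>
definition inverts_on :: "real \<Rightarrow> real \<Rightarrow> bool" where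
  "inverts_on a b \<longleftrightarrow> integrable lborel (\<lambda>x. mean_density F x * indicator {a..b} x) \<and>
    (\<integral>x. mean_density F x * indicator {a..b} x \<partial>lborel)
      = measure \<mu> {a<..<b} + (measure \<mu> {a} + measure \<mu> {b}) / 2"

text \<open>Stieltjes inversion near \<open>x0\<close>: the Poisson integrals converge almost everywhere to the density, with the
integrable majorant of \<open>exp_log_potential_bound\<close>, while their integrals over an interval converge to its mass.\<close>
lemma local_inversion:
  "\<exists>\<delta>>0. \<forall>a b. a < b \<longrightarrow> {a..b} \<subseteq> {x0 - \<delta>..x0 + \<delta>} \<longrightarrow> inverts_on a b"
proof -
  obtain \<delta> where \<delta>: "0 < \<delta>" "\<delta> \<le> 1/3" "measure F {x0 - 2 * \<delta>..x0 + 2 * \<delta>} < 1"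
    using small_ball_not_full[OF no_unit_atom] by metis
  define q where "q = measure F {x0 - 2 * \<delta>..x0 + 2 * \<delta>}"
  have q: "0 \<le> q" "q < 1" using \<delta>(3) by (auto simp: q_def)
  show ?thesis
  proof (intro exI[of _ \<delta>] conjI allI impI \<delta>(1))
    fix a b :: real assume ab: "a < b" "{a..b} \<subseteq> {x0 - \<delta>..x0 + \<delta>}"
    define e where "e n = 1 / real (Suc n)" for n
    have e: "e \<longlonglongrightarrow> 0" "\<And>n. 0 < e n" "\<And>n. e n \<le> 1"
      unfolding e_def using LIMSEQ_Suc[OF lim_1_over_n] by auto
    let ?g = "\<lambda>n x. poisson (e n) x / pi * indicator {a..b} x"
    let ?f = "\<lambda>x. mean_density F x * indicator {a..b} x"
    let ?D = "\<lambda>x. (1 + enn2real (riesz_potential q x) / q) / \<delta> * indicator {a..b} x"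
    have D: "integrable lborel ?D"
    proof -
      have "integrable lborel (\<lambda>x. enn2real (riesz_potential q x))"
      proof (rule integrableI_nonneg)
        have "(\<integral>\<^sup>+x. ennreal (enn2real (riesz_potential q x)) \<partial>lborel) \<le> (\<integral>\<^sup>+x. riesz_potential q x \<partial>lborel)"
          by (intro nn_integral_mono) (simp add: ennreal_enn2real_if)
        then show "(\<integral>\<^sup>+x. ennreal (enn2real (riesz_potential q x)) \<partial>lborel) < \<infinity>"
          using nn_integral_riesz_potential_less_top[OF q(2)] by (rule le_less_trans)
      qed auto
      then have "integrable lborel (\<lambda>x. (1 / q / \<delta>) * enn2real (riesz_potential q x) * indicator {a..b} x)"
        by (intro integrable_real_mult_indicator integrable_mult_right) auto
      moreover have "integrable lborel (\<lambda>x. 1 / \<delta> * indicator {a..b} x)"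
        by (intro integrable_mult_right integrable_real_indicator) (auto simp: emeasure_lborel_Icc_eq)
      ultimately have "integrable lborel (\<lambda>x. 1 / \<delta> * indicator {a..b} x + (1 / q / \<delta>) * enn2real (riesz_potential q x) * indicator {a..b} x)"
        by (rule Bochner_Integration.integrable_add[rotated])
      then show ?thesis by (simp add: algebra_simps add_divide_distrib)
    qed
    have lim: "AE x in lborel. (\<lambda>n. ?g n x) \<longlonglongrightarrow> ?f x"
      using AE_log_potential_integrable AE_lborel_no_atom
    proof eventually_elim
      case (elim x)
      show ?case by (rule tendsto_mult[OF poisson_tendsto[OF elim e] tendsto_const])
    qed
    have bound: "AE x in lborel. norm (?g n x) \<le> ?D x" for n
      using AE_lborel_no_atom AE_riesz_potential_less_top[OF q(2)]
    proof eventually_elim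
      case (elim x)
      show ?case
      proof (cases "x \<in> {a..b}")
        case True
        then have "x \<in> {x0 - \<delta>..x0 + \<delta>}" using ab(2) by blast
        then have x: "\<bar>x - x0\<bar> \<le> \<delta>" by (auto simp: abs_le_iff)
        have "poisson (e n) x / pi \<le> poisson (e n) x / 1"
          using poisson_nonneg[OF e(2)] pi_gt3 by (intro divide_left_mono) auto
        also have "\<dots> \<le> norm (exp (- log_transform (e n) x))"
          using abs_Im_le_cmod[of "exp (- log_transform (e n) x)"] by (simp add: poisson_eq[OF e(2)])
        also have "\<dots> \<le> (1 + enn2real (riesz_potential q x) / q) / \<delta>"
          by (rule exp_log_potential_bound[OF \<delta>(1,2) x e(2) elim(1) q_def elim(2)])
        finally show ?thesis using True poisson_nonneg[OF e(2), of n x] by simp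
      qed simp
    qed
    have f: "integrable lborel ?f"
      by (rule integrable_dominated_convergence[OF _ _ D lim bound]) measurable
    have "(\<lambda>n. \<integral>x. ?g n x \<partial>lborel) \<longlonglongrightarrow> (\<integral>x. ?f x \<partial>lborel)"
      by (rule integral_dominated_convergence[OF _ _ D lim bound]) measurable
    moreover have "(\<integral>x. ?g n x \<partial>lborel) = (\<integral>m. arctan ((b - m) / e n) - arctan ((a - m) / e n) \<partial>\<mu>) / pi" for n
    proof -
      have "(\<integral>x. ?g n x \<partial>lborel) = (\<integral>x. poisson (e n) x * indicator {a..b} x \<partial>lborel) / pi"
        by (simp flip: integral_divide_zero)
      also have "(\<integral>x. poisson (e n) x * indicator {a..b} x \<partial>lborel)
          = enn2real (\<integral>\<^sup>+x. ennreal (poisson (e n) x) * indicator {a..b} x \<partial>lborel)"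
        using poisson_nonneg[OF e(2)]
        by (subst integral_eq_nn_integral) (auto intro!: arg_cong[where f=enn2real] nn_integral_cong simp: indicator_def)
      also have "\<dots> = (\<integral>m. arctan ((b - m) / e n) - arctan ((a - m) / e n) \<partial>\<mu>)"
        using ab(1) e(2)[of n]
        by (subst nn_integral_poisson_Icc)
          (auto intro!: enn2real_ennreal Bochner_Integration.integral_nonneg simp: arctan_le_iff divide_right_mono)
      finally show ?thesis .
    qed
    moreover have "(\<lambda>n. (\<integral>m. arctan ((b - m) / e n) - arctan ((a - m) / e n) \<partial>\<mu>) / pi)
        \<longlonglongrightarrow> (\<integral>m. pi / 2 * sgn (b - m) - pi / 2 * sgn (a - m) \<partial>\<mu>) / pi"
    proof (intro tendsto_divide tendsto_const integral_dominated_convergence[where w="\<lambda>_. pi"] AE_I2)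
      fix m
      show "(\<lambda>n. arctan ((b - m) / e n) - arctan ((a - m) / e n)) \<longlonglongrightarrow> pi / 2 * sgn (b - m) - pi / 2 * sgn (a - m)"
        by (intro tendsto_diff tendsto_arctan_scaled e)
      show "norm (arctan ((b - m) / e n) - arctan ((a - m) / e n)) \<le> pi" for n
        using arctan_bounded[of "(b - m) / e n"] arctan_bounded[of "(a - m) / e n"] by (simp add: abs_le_iff)
    qed auto
    ultimately have "(\<integral>x. ?f x \<partial>lborel) = (\<integral>m. pi / 2 * sgn (b - m) - pi / 2 * sgn (a - m) \<partial>\<mu>) / pi"
      by (simp add: LIMSEQ_unique)
    also have "\<dots> = (\<integral>m. indicator {a<..<b} m + (indicator {a} m + indicator {b} m) / 2 \<partial>\<mu>)"
    proof -
      have "(pi / 2 * sgn (b - m) - pi / 2 * sgn (a - m)) / pi = indicator {a<..<b} m + (indicator {a} m + indicator {b} m) / 2" for m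
        using ab(1) by (auto simp: sgn_if indicator_def field_simps)
      then show ?thesis by (simp flip: integral_divide_zero)
    qed
    also have "\<dots> = measure \<mu> {a<..<b} + (measure \<mu> {a} + measure \<mu> {b}) / 2"
      by (simp add: less_top[symmetric] \<mu>.emeasure_eq_measure)
    finally show "inverts_on a b" using f by (simp add: inverts_on_def)
  qed
qed

text \<open>The mass of a point is at most the integral of the density over arbitrarily short intervals around it.\<close>
lemma no_atom_\<mu>: "measure \<mu> {x} = 0"
proof -
  obtain \<delta> where \<delta>: "0 < \<delta>" and inv: "\<And>a b. a < b \<Longrightarrow> {a..b} \<subseteq> {x - \<delta>..x + \<delta>} \<Longrightarrow> inverts_on a b"
    using local_inversion[of x] by (elim exE conjE) simp
  define r where "r n = \<delta> / real (Suc n)" for n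
  have r: "0 < r n" "r n \<le> \<delta>" for n using \<delta> by (auto simp: r_def field_simps)
  have rlim: "r \<longlonglongrightarrow> 0" unfolding r_def
    using tendsto_mult_right[OF LIMSEQ_Suc[OF lim_1_over_n], of \<delta>] by (simp add: field_simps)
  have sub: "{x - r n..x + r n} \<subseteq> {x - \<delta>..x + \<delta>}" for n using r(2)[of n] by auto
  have "(\<lambda>n. \<integral>y. mean_density F y * indicator {x - r n..x + r n} y \<partial>lborel) \<longlonglongrightarrow> (\<integral>y. 0 \<partial>(lborel :: real measure))"
  proof (rule integral_dominated_convergence[where w="\<lambda>y. mean_density F y * indicator {x - \<delta>..x + \<delta>} y"])
    show "integrable lborel (\<lambda>y. mean_density F y * indicator {x - \<delta>..x + \<delta>} y)"
      using inv[of "x - \<delta>" "x + \<delta>"] \<delta> by (simp add: inverts_on_def)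
    show "AE y in lborel. norm (mean_density F y * indicator {x - r n..x + r n} y) \<le> mean_density F y * indicator {x - \<delta>..x + \<delta>} y" for n
      using sub[of n] mean_density_nonneg by (intro AE_I2) (auto simp: indicator_def)
    have "AE y in lborel. y \<noteq> x" by (rule AE_lborel_singleton)
    then show "AE y in lborel. (\<lambda>n. mean_density F y * indicator {x - r n..x + r n} y) \<longlonglongrightarrow> 0"
    proof eventually_elim
      case (elim y)
      have "\<forall>\<^sub>F n in sequentially. r n < \<bar>y - x\<bar>" using rlim elim by (intro order_tendstoD) auto
      then have "\<forall>\<^sub>F n in sequentially. mean_density F y * indicator {x - r n..x + r n} y = 0"
        by eventually_elim (auto simp: indicator_def)
      then show ?case by (rule tendsto_eventually)
    qed
  qed auto
  moreover have "measure \<mu> {x} \<le> (\<integral>y. mean_density F y * indicator {x - r n..x + r n} y \<partial>lborel)" for n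
  proof -
    have "measure \<mu> {x} \<le> measure \<mu> {x - r n<..<x + r n}"
      using r(1)[of n] by (intro \<mu>.finite_measure_mono) auto
    also have "\<dots> \<le> measure \<mu> {x - r n<..<x + r n} + (measure \<mu> {x - r n} + measure \<mu> {x + r n}) / 2" by simp
    also have "\<dots> = (\<integral>y. mean_density F y * indicator {x - r n..x + r n} y \<partial>lborel)"
      using inv[OF _ sub[of n]] r(1)[of n] by (simp add: inverts_on_def)
    finally show ?thesis .
  qed
  ultimately have "measure \<mu> {x} \<le> 0" by (intro LIMSEQ_le_const) auto
  then show ?thesis using measure_nonneg[of \<mu> "{x}"] by linarith
qed

text \<open>Without atoms the end points do not matter. The local statement extends to all intervals by
bisection, because equality of the two masses is additive over adjacent intervals.\<close>
lemma emeasure_Ioc: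
  assumes "a \<le> b"
  shows "emeasure \<mu> {a<..b} = emeasure (density lborel (\<lambda>x. ennreal (mean_density F x))) {a<..b}"
proof -
  let ?N = "density lborel (\<lambda>x. ennreal (mean_density F x))"
  define agree where "agree a b \<longleftrightarrow> emeasure \<mu> {a<..b} = emeasure ?N {a<..b}" for a b
  have "agree a b"
    using assms
  proof (rule Bolzano[where P=agree])
    fix a b c assume "agree a b" "agree b c" "a \<le> b" "b \<le> c"
    then show "agree a c"
      using plus_emeasure[of "{a<..b}" \<mu> "{b<..c}"] plus_emeasure[of "{a<..b}" ?N "{b<..c}"]
      by (simp add: agree_def ivl_disj_un ivl_disj_int)
  next
    fix x
    obtain \<delta> where \<delta>: "0 < \<delta>" and inv: "\<And>a b. a < b \<Longrightarrow> {a..b} \<subseteq> {x - \<delta>..x + \<delta>} \<Longrightarrow> inverts_on a b"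
      using local_inversion[of x] by (elim exE conjE) simp
    have "agree a b" if ab: "a \<le> x" "x \<le> b" "b - a < \<delta>" for a b
    proof (cases "a = b")
      case False
      then have ab': "a < b" "{a..b} \<subseteq> {x - \<delta>..x + \<delta>}" using ab by auto
      have "emeasure ?N {a<..b} = (\<integral>\<^sup>+y. ennreal (mean_density F y) * indicator {a<..b} y \<partial>lborel)"
        by (subst emeasure_density) auto
      also have "\<dots> = (\<integral>\<^sup>+y. ennreal (mean_density F y * indicator {a..b} y) \<partial>lborel)"
        using AE_lborel_singleton[of a] by (intro nn_integral_cong_AE, eventually_elim) (auto simp: indicator_def)
      also have "\<dots> = ennreal (\<integral>y. mean_density F y * indicator {a..b} y \<partial>lborel)"
        using inv[OF ab'] mean_density_nonneg by (intro nn_integral_eq_integral) (auto simp: inverts_on_def)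
      also have "\<dots> = ennreal (measure \<mu> {a<..<b})" using inv[OF ab'] by (simp add: no_atom_\<mu> inverts_on_def)
      also have "measure \<mu> {a<..<b} = measure \<mu> ({a<..<b} \<union> {b})"
        by (subst \<mu>.finite_measure_Union) (auto simp: no_atom_\<mu>)
      also have "{a<..<b} \<union> {b} = {a<..b}" using ab' by auto
      finally show ?thesis by (simp add: agree_def \<mu>.emeasure_eq_measure)
    qed (simp add: agree_def)
    then show "\<exists>d>0. \<forall>a b. a \<le> x \<and> x \<le> b \<and> b - a < d \<longrightarrow> agree a b" using \<delta> by blast
  qed
  then show ?thesis by (simp add: agree_def)
qed

theorem \<mu>_eq_density: "\<mu> = density lborel (\<lambda>x. ennreal (mean_density F x))"
proof (rule measure_eqI_generator_eq)
  let ?E = "range (\<lambda>(a, b). {a<..b::real})"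
  show "Int_stable ?E" by (auto simp: Int_stable_def Int_greaterThanAtMost)
  show "?E \<subseteq> Pow UNIV" by simp
  show "emeasure \<mu> A = emeasure (density lborel (\<lambda>x. ennreal (mean_density F x))) A" if A: "A \<in> ?E" for A
  proof -
    obtain a b where "A = {a<..b}" using A by auto
    then show ?thesis using emeasure_Ioc[of a b] by (cases "a \<le> b") auto
  qed
  show "sets \<mu> = sigma_sets UNIV ?E" by (subst sets_\<mu>, subst borel_sigma_sets_Ioc) simp
  then show "sets (density lborel (\<lambda>x. ennreal (mean_density F x))) = sigma_sets UNIV ?E" by simp
  show "range (\<lambda>n::nat. {- real n<..real n}) \<subseteq> ?E" by auto
  show "(\<Union>n::nat. {- real n<..real n}) = UNIV"
  proof safe
    fix x :: real
    obtain n where "\<bar>x\<bar> < real n" using reals_Archimedean2 by blast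
    then show "x \<in> (\<Union>n::nat. {- real n<..real n})" by (intro UN_I[of n]) auto
  qed auto
qed auto

end

section \<open>Laws of Dirichlet means\<close>

text \<open>The substitution \<open>v = (1 + w) * x / (1 + w * x)\<close> maps the unit interval onto itself and turns the beta integral
into the beta integral against \<open>1 / (1 + w * x)\<close>, up to a power of \<open>1 + w\<close>.\<close>
lemma nn_integral_beta_stieltjes:
  assumes \<sigma>: "0 < \<sigma>" "\<sigma> < 1" and w: "0 \<le> w"
  shows "(\<integral>\<^sup>+x. ennreal (1 / (1 + w * x)) \<partial>beta_distr \<sigma> (1 - \<sigma>)) = ennreal ((1 + w) powr - \<sigma>)"
proof -
  define f where "f v = v powr (\<sigma> - 1) * (1 - v) powr - \<sigma>" for v :: real
  define g where "g x = (1 + w) * x / (1 + w * x)" for x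
  define g' where "g' x = (1 + w) / (1 + w * x)\<^sup>2" for x
  have pos: "0 < 1 + w * x" if "0 \<le> x" for x using w that by (intro add_pos_nonneg) auto
  have B: "0 < Beta \<sigma> (1 - \<sigma>)" using \<sigma> by (simp add: Beta_def)
  have f0: "0 \<le> f x" for x by (simp add: f_def)
  have [measurable]: "f \<in> borel_measurable borel" unfolding f_def by measurable
  have key: "f (g x) * g' x = (1 + w) powr \<sigma> * (f x / (1 + w * x))" if x: "0 < x" "x < 1" for x
  proof -
    have p: "0 < 1 + w * x" "0 < 1 + w" using pos[of x] x w by auto
    have 1: "1 - g x = (1 - x) / (1 + w * x)" using p by (simp add: g_def field_simps)
    have "(1 + w * x) powr (1 - \<sigma>) = inverse ((1 + w * x) powr (\<sigma> - 1))"
      using powr_minus[of "1 + w * x" "\<sigma> - 1"] by simp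
    then have "g x powr (\<sigma> - 1) = (1 + w) powr (\<sigma> - 1) * x powr (\<sigma> - 1) * (1 + w * x) powr (1 - \<sigma>)"
      using p x by (simp add: g_def powr_divide powr_mult divide_inverse inverse_powr)
    moreover have "(1 - g x) powr - \<sigma> = (1 - x) powr - \<sigma> * (1 + w * x) powr \<sigma>"
      unfolding 1 using p x by (simp add: powr_divide powr_minus field_simps)
    moreover have "(1 + w * x) powr (1 - \<sigma>) * (1 + w * x) powr \<sigma> = 1 + w * x"
      using p by (simp flip: powr_add)
    moreover have "(1 + w) powr (\<sigma> - 1) * (1 + w) = (1 + w) powr \<sigma>"
      using p by (simp add: powr_diff)
    ultimately have "f (g x) * g' x = (1 + w) powr \<sigma> * f x * ((1 + w * x) / (1 + w * x)\<^sup>2)"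
      by (simp add: f_def g'_def mult_ac)
    then show ?thesis using p by (simp add: power2_eq_square)
  qed
  have "ennreal (Beta \<sigma> (1 - \<sigma>)) = (\<integral>\<^sup>+v. ennreal (f v) * indicator {0..1} v \<partial>lborel)"
    using has_integral_Beta_real[of \<sigma> "1 - \<sigma>"] \<sigma> unfolding f_def
    by (intro nn_integral_has_integral_lebesgue'[symmetric]) auto
  also have "\<dots> = (\<integral>\<^sup>+v. ennreal (f v * indicator {g 0..g 1} v) \<partial>lborel)"
    using w by (intro nn_integral_cong) (auto simp: g_def indicator_def)
  also have "\<dots> = (\<integral>\<^sup>+x. ennreal (f (g x) * g' x * indicator {0..1} x) \<partial>lborel)"
  proof (rule nn_integral_substitution)
    show "(g has_real_derivative g' x) (at x)" if "x \<in> {0..1}" for x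
      unfolding g_def[abs_def] g'_def using pos[of x] that
      by (auto intro!: derivative_eq_intros simp: power2_eq_square field_simps)
    show "continuous_on {0..1} g'"
      unfolding g'_def[abs_def] using pos by (intro continuous_intros) fastforce
    show "0 \<le> g' x" for x using w by (simp add: g'_def)
    show "set_borel_measurable borel {g 0..g 1} f" by (simp add: set_borel_measurable_def)
  qed simp
  also have "\<dots> = (\<integral>\<^sup>+x. ennreal ((1 + w) powr \<sigma>) * ennreal (f x / (1 + w * x) * indicator {0..1} x) \<partial>lborel)"
    using AE_lborel_singleton[of 0] AE_lborel_singleton[of 1]
    by (intro nn_integral_cong_AE, eventually_elim)
      (auto simp: indicator_def key ennreal_mult'[symmetric])
  also have "\<dots> = ennreal ((1 + w) powr \<sigma>) * (\<integral>\<^sup>+x. ennreal (f x / (1 + w * x) * indicator {0..1} x) \<partial>lborel)"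
    by (intro nn_integral_cmult) measurable
  finally have *: "ennreal (Beta \<sigma> (1 - \<sigma>))
      = ennreal ((1 + w) powr \<sigma>) * (\<integral>\<^sup>+x. ennreal (f x / (1 + w * x) * indicator {0..1} x) \<partial>lborel)" .
  let ?b = "\<lambda>x. if 0 < x \<and> x < 1 then x powr (\<sigma> - 1) * (1 - x) powr (1 - \<sigma> - 1) / Beta \<sigma> (1 - \<sigma>) else 0"
  have "(\<integral>\<^sup>+x. ennreal (1 / (1 + w * x)) \<partial>beta_distr \<sigma> (1 - \<sigma>))
      = (\<integral>\<^sup>+x. ennreal (?b x) * ennreal (1 / (1 + w * x)) \<partial>lborel)"
    using \<sigma> unfolding beta_distr_def by (simp add: nn_integral_density)
  also have "\<dots> = (\<integral>\<^sup>+x. ennreal (1 / Beta \<sigma> (1 - \<sigma>)) * ennreal (f x / (1 + w * x) * indicator {0..1} x) \<partial>lborel)"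
  proof (rule nn_integral_cong_AE, use AE_lborel_singleton[of 0] AE_lborel_singleton[of 1] in eventually_elim)
    case (elim x)
    show ?case
    proof (cases "0 < x \<and> x < 1")
      case True
      then have "0 \<le> 1 / (1 + w * x)" using pos[of x] by simp
      then have "ennreal (?b x) * ennreal (1 / (1 + w * x)) = ennreal (?b x * (1 / (1 + w * x)))"
        using True B by (intro ennreal_mult[symmetric]) auto
      also have "\<dots> = ennreal (1 / Beta \<sigma> (1 - \<sigma>) * (f x / (1 + w * x)))"
        using True by (simp add: f_def mult_ac)
      also have "\<dots> = ennreal (1 / Beta \<sigma> (1 - \<sigma>)) * ennreal (f x / (1 + w * x))"
        using True B pos[of x] f0[of x] by (intro ennreal_mult) auto
      finally show ?thesis using True by simp
    qed (use elim in \<open>auto simp: indicator_def\<close>)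
  qed
  also have "\<dots> = ennreal (1 / Beta \<sigma> (1 - \<sigma>)) * (\<integral>\<^sup>+x. ennreal (f x / (1 + w * x) * indicator {0..1} x) \<partial>lborel)"
    by (intro nn_integral_cmult) measurable
  also have "(\<integral>\<^sup>+x. ennreal (f x / (1 + w * x) * indicator {0..1} x) \<partial>lborel)
      = ennreal ((1 + w) powr - \<sigma>) * ennreal (Beta \<sigma> (1 - \<sigma>))"
    unfolding * using w by (simp flip: mult.assoc ennreal_mult powr_add)
  also have "ennreal (1 / Beta \<sigma> (1 - \<sigma>)) * \<dots> = ennreal ((1 + w) powr - \<sigma>)"
    using B by (simp flip: ennreal_mult add: field_simps)
  finally show ?thesis .
qed

lemma beta_distr_stieltjes:
  assumes \<sigma>: "0 < \<sigma>" "\<sigma> \<le> 1" and w: "0 \<le> w"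
  shows "(\<integral>x. 1 / (1 + w * x) \<partial>beta_distr \<sigma> (1 - \<sigma>)) = (1 + w) powr - \<sigma>"
proof (cases "\<sigma> = 1")
  case True
  then show ?thesis using w by (simp add: beta_distr_def integral_return powr_minus_divide)
next
  case False
  with \<sigma> have \<sigma>': "\<sigma> < 1" by simp
  have "(\<integral>x. 1 / (1 + w * x) \<partial>beta_distr \<sigma> (1 - \<sigma>))
      = enn2real (\<integral>\<^sup>+x. ennreal (1 / (1 + w * x)) \<partial>beta_distr \<sigma> (1 - \<sigma>))"
  proof (rule integral_eq_nn_integral)
    show "AE x in beta_distr \<sigma> (1 - \<sigma>). 0 \<le> 1 / (1 + w * x)"
      using \<sigma>' w unfolding beta_distr_def by (auto simp: AE_density)
  qed (auto simp: beta_distr_def)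
  then show ?thesis by (simp add: nn_integral_beta_stieltjes[OF \<sigma>(1) \<sigma>' w])
qed

lemma sets_beta_distr [simp, measurable_cong]: "sets (beta_distr a b) = sets borel"
  by (simp add: beta_distr_def)

lemma AE_beta_distr_nonneg: "AE x in beta_distr a b. 0 \<le> x"
  unfolding beta_distr_def by (auto simp: AE_density AE_return)

lemma (in half_line_prob) dirichlet_mean_1_law:
  assumes atom: "\<And>x. measure F {x} \<noteq> 1" and dp: "dirichlet_process \<Omega> 1 F P"
  shows "distributed \<Omega> lborel (dirichlet_mean P) (\<lambda>x. ennreal (mean_density F x))"
proof -
  interpret \<Omega>: prob_space \<Omega> by (rule dirichlet_processD(1)[OF dp])
  note T = dirichlet_process_mean_transform[OF dp zero_less_one]
  note [measurable] = T(1)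
  interpret stieltjes_pair F "distr \<Omega> borel (dirichlet_mean P)"
  proof (intro stieltjes_pair.intro stieltjes_pair_axioms.intro half_line_prob_axioms \<Omega>.prob_space_distr atom)
    show "AE m in distr \<Omega> borel (dirichlet_mean P). 0 \<le> m"
      using T(2) by (subst AE_distr_iff) (auto intro!: AE_I2)
    fix l :: real assume l: "0 < l"
    have "(\<integral>m. 1 / (1 + l * m) \<partial>distr \<Omega> borel (dirichlet_mean P)) = (\<integral>\<omega>. 1 / (1 + l * dirichlet_mean P \<omega>) \<partial>\<Omega>)"
      by (subst integral_distr) auto
    also have "\<dots> = (\<integral>\<omega>. (1 + l * dirichlet_mean P \<omega>) powr - 1 \<partial>\<Omega>)"
      using T(2) l by (intro Bochner_Integration.integral_cong refl) (simp add: powr_minus_divide)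
    finally show "(\<integral>m. 1 / (1 + l * m) \<partial>distr \<Omega> borel (dirichlet_mean P)) = exp (- psi F l)"
      using T(3)[OF l] by simp
  qed auto
  have "distr \<Omega> lborel (dirichlet_mean P) = distr \<Omega> borel (dirichlet_mean P)" by (rule distr_cong) auto
  then show ?thesis using \<mu>_eq_density by (simp add: distributed_def)
qed

text \<open>By the beta integral, the conditional expectation of \<open>1 / (1 + l * (B * D))\<close> given the mean \<open>D\<close> is \<open>(1 + l * D) powr - \<sigma>\<close>.
So the product has the Stieltjes transform \<open>exp (- psi F l)\<close>, and inversion determines its law.\<close>
lemma (in half_line_prob) beta_times_dirichlet_mean_law:
  assumes atom: "\<And>x. measure F {x} \<noteq> 1" and \<sigma>: "0 < \<sigma>" "\<sigma> \<le> 1"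
    and G: "half_line_prob G" and psi: "\<And>l. 0 < l \<Longrightarrow> psi F l = \<sigma> * psi G l"
    and dp: "dirichlet_process \<Omega> \<sigma> G Q"
    and B: "distr \<Omega> borel B = beta_distr \<sigma> (1 - \<sigma>)"
    and indep: "prob_space.indep_var \<Omega> borel B borel (dirichlet_mean Q)"
  shows "distr \<Omega> borel (\<lambda>\<omega>. B \<omega> * dirichlet_mean Q \<omega>) = density lborel (\<lambda>x. ennreal (mean_density F x))"
proof -
  interpret \<Omega>: prob_space \<Omega> by (rule dirichlet_processD(1)[OF dp])
  interpret G: half_line_prob G by fact
  note T = G.dirichlet_process_mean_transform[OF dp \<sigma>(1)]
  let ?D = "dirichlet_mean Q"
  have [measurable]: "?D \<in> borel_measurable \<Omega>" "B \<in> borel_measurable \<Omega>"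
    using \<Omega>.indep_var_rv1[OF indep] T(1) by auto
  have B0: "AE \<omega> in \<Omega>. 0 \<le> B \<omega>"
    using AE_beta_distr_nonneg[of \<sigma> "1 - \<sigma>"] unfolding B[symmetric] by (subst (asm) AE_distr_iff) auto
  have D0: "AE \<omega> in \<Omega>. 0 \<le> ?D \<omega>" using T(2) by (intro AE_I2)
  have joint: "distr \<Omega> borel B \<Otimes>\<^sub>M distr \<Omega> borel ?D = distr \<Omega> (borel \<Otimes>\<^sub>M borel) (\<lambda>\<omega>. (B \<omega>, ?D \<omega>))"
    using indep unfolding \<Omega>.indep_var_distribution_eq by simp
  interpret PB: prob_space "distr \<Omega> borel B" by (rule \<Omega>.prob_space_distr) simp
  interpret PD: prob_space "distr \<Omega> borel ?D" by (rule \<Omega>.prob_space_distr) simp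
  interpret P: pair_prob_space "distr \<Omega> borel B" "distr \<Omega> borel ?D" ..
  interpret stieltjes_pair F "distr \<Omega> borel (\<lambda>\<omega>. B \<omega> * ?D \<omega>)"
  proof (intro stieltjes_pair.intro stieltjes_pair_axioms.intro half_line_prob_axioms \<Omega>.prob_space_distr atom)
    show "AE m in distr \<Omega> borel (\<lambda>\<omega>. B \<omega> * ?D \<omega>). 0 \<le> m"
    proof (subst AE_distr_iff)
      show "AE \<omega> in \<Omega>. 0 \<le> B \<omega> * ?D \<omega>" using B0 D0 by eventually_elim simp
    qed auto
    fix l :: real assume l: "0 < l"
    let ?h = "\<lambda>(b, d). 1 / (1 + l * (b * d)) :: real"
    have nn: "AE p in distr \<Omega> (borel \<Otimes>\<^sub>M borel) (\<lambda>\<omega>. (B \<omega>, ?D \<omega>)). 0 \<le> fst p \<and> 0 \<le> snd p"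
    proof (subst AE_distr_iff)
      show "AE \<omega> in \<Omega>. 0 \<le> fst (B \<omega>, ?D \<omega>) \<and> 0 \<le> snd (B \<omega>, ?D \<omega>)" using B0 D0 by eventually_elim simp
    qed auto
    have int: "integrable (distr \<Omega> borel B \<Otimes>\<^sub>M distr \<Omega> borel ?D) ?h"
    proof (rule P.integrable_const_bound)
      show "AE p in distr \<Omega> borel B \<Otimes>\<^sub>M distr \<Omega> borel ?D. norm (?h p) \<le> 1"
        using nn unfolding joint by eventually_elim (use l in \<open>auto simp: divide_le_eq\<close>)
    qed measurable
    have "(\<integral>m. 1 / (1 + l * m) \<partial>distr \<Omega> borel (\<lambda>\<omega>. B \<omega> * ?D \<omega>)) = (\<integral>\<omega>. ?h (B \<omega>, ?D \<omega>) \<partial>\<Omega>)"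
      by (subst integral_distr) auto
    also have "\<dots> = (\<integral>p. ?h p \<partial>distr \<Omega> (borel \<Otimes>\<^sub>M borel) (\<lambda>\<omega>. (B \<omega>, ?D \<omega>)))"
      by (subst integral_distr) auto
    also have "\<dots> = (\<integral>d. \<integral>b. 1 / (1 + (l * d) * b) \<partial>distr \<Omega> borel B \<partial>distr \<Omega> borel ?D)"
      unfolding joint[symmetric] using int by (subst P.integral_snd[symmetric]) (auto simp: mult_ac)
    also have "\<dots> = (\<integral>\<omega>. (\<integral>b. 1 / (1 + (l * ?D \<omega>) * b) \<partial>distr \<Omega> borel B) \<partial>\<Omega>)"
      by (subst integral_distr) auto
    also have "\<dots> = (\<integral>\<omega>. (1 + l * ?D \<omega>) powr - \<sigma> \<partial>\<Omega>)"
      unfolding B using T(2) l \<sigma> by (intro Bochner_Integration.integral_cong refl beta_distr_stieltjes) auto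
    also have "\<dots> = exp (- psi F l)" using T(3)[OF l] psi[OF l] by simp
    finally show "(\<integral>m. 1 / (1 + l * m) \<partial>distr \<Omega> borel (\<lambda>\<omega>. B \<omega> * ?D \<omega>)) = exp (- psi F l)" .
  qed auto
  show ?thesis by (rule \<mu>_eq_density)
qed

section \<open>The map from \<open>x\<close> to \<open>c * x / (c * x + 1)\<close>\<close>
definition squash :: "real \<Rightarrow> real \<Rightarrow> real" where
  "squash c t = c * t / (c * t + 1)"

lemma borel_measurable_squash [measurable]: "squash c \<in> borel_measurable borel"
  unfolding squash_def by measurable

context
  fixes c :: real
  assumes c: "0 < c"
begin

lemma squash_bounds: "0 \<le> t \<Longrightarrow> 0 \<le> squash c t" "0 \<le> t \<Longrightarrow> squash c t < 1"
proof -
  assume t: "0 \<le> t"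
  then have "0 < c * t + 1" using c by (intro add_nonneg_pos) auto
  then show "0 \<le> squash c t" "squash c t < 1" using t c by (auto simp: squash_def)
qed

lemma squash_diff:
  assumes "0 \<le> x" "0 \<le> t"
  shows "squash c x - squash c t = c * (x - t) * (1 - squash c x) / (1 + c * t)"
proof -
  have "0 < c * x + 1" "0 < c * t + 1" using assms c by (auto intro!: add_nonneg_pos)
  then show ?thesis by (simp add: squash_def field_simps)
qed

lemma squash_le_iff:
  assumes "0 \<le> x" "0 \<le> t"
  shows "squash c t \<le> squash c x \<longleftrightarrow> t \<le> x"
proof -
  have "0 < 1 + c * t" using assms c by (auto intro!: add_pos_nonneg)
  then have "0 \<le> squash c x - squash c t \<longleftrightarrow> 0 \<le> x - t"
    unfolding squash_diff[OF assms] using c squash_bounds(2)[OF assms(1)]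
    by (simp add: zero_le_divide_iff zero_le_mult_iff)
  then show ?thesis by simp
qed

lemma squash_eq_iff: "0 \<le> x \<Longrightarrow> 0 \<le> t \<Longrightarrow> squash c t = squash c x \<longleftrightarrow> t = x"
  using squash_le_iff[of x t] squash_le_iff[of t x] by auto

lemma squash_inverse:
  assumes "0 \<le> y" "y < 1"
  shows "squash c (y / (c * (1 - y))) = y" "0 \<le> y / (c * (1 - y))"
  using assms c by (auto simp: squash_def field_simps)

end

context half_line_prob
begin

lemma half_line_prob_squash:
  assumes c: "0 < c" shows "half_line_prob (distr F borel (squash c))"
proof -
  have pos: "AE a in distr F borel (squash c). 0 \<le> a \<and> a < 1"
    using nonneg by (subst AE_distr_iff) (auto elim!: AE_mp simp: squash_bounds[OF c])
  interpret D: prob_space "distr F borel (squash c)" by (rule prob_space_distr) simp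
  show ?thesis
  proof
    show "AE t in distr F borel (squash c). 0 \<le> t" using pos by eventually_elim simp
    show "integrable (distr F borel (squash c)) (\<lambda>t. ln (1 + l * t))" if "0 < l" for l
    proof (rule D.integrable_const_bound)
      show "AE t in distr F borel (squash c). norm (ln (1 + l * t)) \<le> ln (1 + l)"
        using pos
      proof eventually_elim
        case (elim t)
        then have "1 \<le> 1 + l * t" "l * t \<le> l * 1" using that by (auto intro!: mult_left_mono)
        then show ?case by simp
      qed
    qed measurable
  qed simp
qed

text \<open>The two sets may differ on the negative half-line, which has mass 0.\<close>
lemma measure_squash:
  assumes B: "B \<in> sets borel" "B' \<in> sets borel" and eq: "\<And>t. 0 \<le> t \<Longrightarrow> squash c t \<in> B \<longleftrightarrow> t \<in> B'"
  shows "measure (distr F borel (squash c)) B = measure F B'"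
proof -
  have "measure (distr F borel (squash c)) B = measure F (squash c -` B)"
    using B by (subst measure_distr) auto
  also have "\<dots> = measure F B'"
  proof (rule finite_measure_eq_AE)
    show "AE t in F. t \<in> squash c -` B \<longleftrightarrow> t \<in> B'" using nonneg by eventually_elim (simp add: eq)
    show "squash c -` B \<in> events" using measurable_sets[OF borel_measurable_squash B(1), of c] by simp
  qed (use B in simp)
  finally show ?thesis .
qed

text \<open>The fractional linear map changes distances by explicit factors, by \<open>squash_diff\<close>, so the logarithmic
potentials differ by elementary terms and by \<open>psi F c\<close>. The point \<open>x\<close> must not be an atom, because at
\<open>t = x\<close> both logarithms are 0 by convention and violate the relation.\<close>
lemma Phi_squash:
  assumes c: "0 < c" and x: "0 \<le> x" and atom: "measure F {x} = 0"
  defines "G \<equiv> distr F borel (squash c)"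
  shows "integrable G (\<lambda>a. ln \<bar>squash c x - a\<bar>) \<longleftrightarrow> integrable F (\<lambda>t. ln \<bar>x - t\<bar>)"
    and "integrable F (\<lambda>t. ln \<bar>x - t\<bar>) \<Longrightarrow>
      Phi G (squash c x) = Phi F x + ln c + ln (1 - squash c x) - psi F c"
proof -
  interpret G: half_line_prob G unfolding G_def by (rule half_line_prob_squash[OF c])
  let ?k = "ln c + ln (1 - squash c x)"
  let ?f = "\<lambda>t. ln \<bar>x - t\<bar>" and ?h = "\<lambda>t. ?k - ln (1 + c * t)" and ?g = "\<lambda>t. ln \<bar>squash c x - squash c t\<bar>"
  have eq: "AE t in F. ?g t = ?f t + ?h t"
    using nonneg AE_neq_of_no_atom[OF atom]
  proof eventually_elim
    case (elim t)
    have p: "0 < 1 + c * t" "0 < 1 - squash c x" "0 < \<bar>x - t\<bar>"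
      using elim c squash_bounds(2)[OF c x] by (auto intro!: add_pos_nonneg)
    have "\<bar>squash c x - squash c t\<bar> = c * \<bar>x - t\<bar> * (1 - squash c x) / (1 + c * t)"
      unfolding squash_diff[OF c x elim(1)] using p c by (simp add: abs_mult)
    also have "ln \<dots> = ln c + ln \<bar>x - t\<bar> + ln (1 - squash c x) - ln (1 + c * t)"
      using p c by (simp add: ln_mult_pos ln_div)
    finally show ?case by simp
  qed
  have h: "integrable F ?h" using log_integrable[OF c] by simp
  have dg: "integrable G (\<lambda>a. ln \<bar>squash c x - a\<bar>) \<longleftrightarrow> integrable F ?g"
    unfolding G_def by (subst integrable_distr_eq) auto
  also have "\<dots> \<longleftrightarrow> integrable F (\<lambda>t. ?f t + ?h t)"
    by (rule integrable_cong_AE) (use eq in auto)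
  also have "\<dots> \<longleftrightarrow> integrable F ?f"
  proof
    assume "integrable F (\<lambda>t. ?f t + ?h t)"
    from Bochner_Integration.integrable_diff[OF this h] show "integrable F ?f" by simp
  qed (use h in auto)
  finally show "integrable G (\<lambda>a. ln \<bar>squash c x - a\<bar>) \<longleftrightarrow> integrable F ?f" .
  assume f: "integrable F ?f"
  have "Phi G (squash c x) = (\<integral>a. ln \<bar>squash c x - a\<bar> \<partial>G)" by (rule G.Phi_eq)
  also have "\<dots> = (\<integral>t. ?g t \<partial>F)" unfolding G_def by (subst integral_distr) auto
  also have "\<dots> = (\<integral>t. ?f t + ?h t \<partial>F)" by (rule integral_cong_AE) (use eq in auto)
  also have "\<dots> = Phi F x + (\<integral>t. ?h t \<partial>F)" using f h by (simp add: Phi_eq)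
  also have "(\<integral>t. ?h t \<partial>F) = ?k - psi F c"
    using log_integrable[OF c] prob_space by (simp add: psi_def)
  finally show "Phi G (squash c x) = Phi F x + ln c + ln (1 - squash c x) - psi F c" by simp
qed

end

section \<open>Thinning by an independent Bernoulli variable\<close>

text \<open>\<open>X\<close> is kept with probability \<open>\<sigma>\<close> and otherwise replaced by 0, independently of its value.\<close>
locale bernoulli_thinning = prob_space M for M :: "'a measure" +
  fixes X Y :: "'a \<Rightarrow> real" and \<sigma> :: real
  assumes X [measurable]: "X \<in> borel_measurable M" and Y [measurable]: "Y \<in> borel_measurable M"
    and \<sigma>: "0 < \<sigma>" "\<sigma> \<le> 1"
    and law_Y: "law M Y = distr (measure_pmf (bernoulli_pmf \<sigma>)) borel of_bool"
    and indep: "indep_var borel X borel Y"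
    and law_X: "half_line_prob (law M X)"
begin

abbreviation "G \<equiv> law M X"
abbreviation "F \<equiv> law M (\<lambda>\<omega>. X \<omega> * Y \<omega>)"

sublocale G: half_line_prob G by (rule law_X)

lemma AE_Y: "AE \<omega> in M. Y \<omega> = 0 \<or> Y \<omega> = 1"
proof -
  have "AE y in law M Y. y = 0 \<or> y = 1"
    unfolding law_Y by (subst AE_distr_iff) (auto simp: AE_measure_pmf_iff)
  then show ?thesis by (subst (asm) AE_distr_iff) auto
qed

lemma expectation_Y: "expectation Y = \<sigma>"
proof -
  have "expectation Y = (\<integral>y. y \<partial>law M Y)" by (subst integral_distr) auto
  also have "\<dots> = measure_pmf.expectation (bernoulli_pmf \<sigma>) of_bool"
    unfolding law_Y by (subst integral_distr) auto
  also have "\<dots> = \<sigma>" using \<sigma> by simp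
  finally show ?thesis .
qed

lemma integrable_Y: "integrable M Y"
proof (rule integrable_const_bound)
  show "AE \<omega> in M. norm (Y \<omega>) \<le> 1" using AE_Y by eventually_elim auto
qed measurable

lemma thinned_integral:
  fixes g :: "real \<Rightarrow> real"
  assumes g [measurable]: "g \<in> borel_measurable borel" and int: "integrable G g"
  shows "integrable F g" "(\<integral>x. g x \<partial>F) = \<sigma> * (\<integral>x. g x \<partial>G) + (1 - \<sigma>) * g 0"
proof -
  have gX: "integrable M (\<lambda>\<omega>. g (X \<omega>))" using int by (subst (asm) integrable_distr_eq) auto
  have iv: "indep_var borel (\<lambda>\<omega>. g (X \<omega>)) borel Y"
    using indep_var_compose[OF indep g measurable_ident] by (simp add: comp_def)
  have eq: "AE \<omega> in M. g (X \<omega> * Y \<omega>) = g (X \<omega>) * Y \<omega> + g 0 * (1 - Y \<omega>)"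
    using AE_Y by eventually_elim auto
  have i: "integrable M (\<lambda>\<omega>. g (X \<omega>) * Y \<omega>)" using indep_var_integrable[OF iv gX integrable_Y] .
  have i2: "integrable M (\<lambda>\<omega>. g 0 * (1 - Y \<omega>))" using integrable_Y by simp
  have "integrable M (\<lambda>\<omega>. g (X \<omega> * Y \<omega>)) \<longleftrightarrow> integrable M (\<lambda>\<omega>. g (X \<omega>) * Y \<omega> + g 0 * (1 - Y \<omega>))"
    by (rule integrable_cong_AE) (use eq in auto)
  then show "integrable F g" using i i2 by (subst integrable_distr_eq) auto
  have "(\<integral>x. g x \<partial>F) = (\<integral>\<omega>. g (X \<omega> * Y \<omega>) \<partial>M)" by (subst integral_distr) auto
  also have "\<dots> = (\<integral>\<omega>. g (X \<omega>) * Y \<omega> + g 0 * (1 - Y \<omega>) \<partial>M)"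
    by (rule integral_cong_AE) (use eq in auto)
  also have "\<dots> = (\<integral>\<omega>. g (X \<omega>) * Y \<omega> \<partial>M) + (\<integral>\<omega>. g 0 * (1 - Y \<omega>) \<partial>M)"
    by (rule Bochner_Integration.integral_add[OF i i2])
  also have "(\<integral>\<omega>. g (X \<omega>) * Y \<omega> \<partial>M) = (\<integral>\<omega>. g (X \<omega>) \<partial>M) * \<sigma>"
    using indep_var_lebesgue_integral[OF iv gX integrable_Y] by (simp add: expectation_Y)
  also have "(\<integral>\<omega>. g (X \<omega>) \<partial>M) = (\<integral>x. g x \<partial>G)" by (subst integral_distr) auto
  also have "(\<integral>\<omega>. g 0 * (1 - Y \<omega>) \<partial>M) = g 0 * (1 - \<sigma>)"
    using integrable_Y expectation_Y prob_space by simp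
  finally show "(\<integral>x. g x \<partial>F) = \<sigma> * (\<integral>x. g x \<partial>G) + (1 - \<sigma>) * g 0" by (simp add: mult_ac)
qed

sublocale F: half_line_prob F
proof -
  interpret F: prob_space F by (rule prob_space_distr) simp
  have "AE \<omega> in M. 0 \<le> X \<omega>" using G.nonneg by (subst (asm) AE_distr_iff) auto
  then have "AE \<omega> in M. 0 \<le> X \<omega> * Y \<omega>" using AE_Y by eventually_elim auto
  then show "half_line_prob F"
    by unfold_locales (auto simp: AE_distr_iff intro!: thinned_integral(1) G.log_integrable)
qed

lemma measure_F: "B \<in> sets borel \<Longrightarrow> measure F B = \<sigma> * measure G B + (1 - \<sigma>) * indicator B 0"
  using thinned_integral(2)[of "indicator B"] by (simp add: G.emeasure_eq_measure)

lemma psi_F: "0 < l \<Longrightarrow> psi F l = \<sigma> * psi G l"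
  unfolding psi_def using thinned_integral(2)[OF _ G.log_integrable, of l] by simp

lemma Phi_F:
  assumes "0 < x" "integrable G (\<lambda>t. ln \<bar>x - t\<bar>)"
  shows "Phi F x = \<sigma> * Phi G x + (1 - \<sigma>) * ln x"
  unfolding F.Phi_eq G.Phi_eq using thinned_integral(2)[OF _ assms(2)] assms(1) by simp

lemma cdf_F: "0 \<le> x \<Longrightarrow> cdf F x = \<sigma> * cdf G x + (1 - \<sigma>)"
  unfolding cdf_def by (subst measure_F) auto

text \<open>The atom of mass \<open>1 - \<sigma>\<close> at the origin contributes the power of \<open>x\<close>.\<close>
lemma mean_density_F:
  assumes "0 < x" "integrable G (\<lambda>t. ln \<bar>x - t\<bar>)"
  shows "mean_density F x = x powr (\<sigma> - 1) * sin (pi * cdf F x) * exp (- \<sigma> * Phi G x) / pi"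
proof -
  have "exp (- Phi F x) = exp (- \<sigma> * Phi G x) * exp ((\<sigma> - 1) * ln x)"
    unfolding Phi_F[OF assms] by (simp flip: exp_add add: algebra_simps)
  also have "exp ((\<sigma> - 1) * ln x) = x powr (\<sigma> - 1)" using assms(1) by (simp add: powr_def)
  finally show ?thesis by (simp add: mean_density_def mult_ac)
qed

lemma mean_density_F_neg: "x < 0 \<Longrightarrow> mean_density F x = 0"
proof -
  assume x: "x < 0"
  have "AE t in F. t \<notin> {..x}" using F.nonneg by eventually_elim (use x in auto)
  then have "cdf F x = 0" unfolding cdf_def by (subst F.prob_eq_0) auto
  then show ?thesis by (simp add: mean_density_def)
qed

lemma law_of_mean:
  assumes "\<And>x. measure F {x} \<noteq> 1" "dirichlet_process \<Omega> 1 F P"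
  shows "law \<Omega> (dirichlet_mean P) = density lborel (\<lambda>x. ennreal (mean_density F x))"
proof -
  have "law \<Omega> (dirichlet_mean P) = distr \<Omega> lborel (dirichlet_mean P)" by (rule distr_cong) auto
  then show ?thesis using F.dirichlet_mean_1_law[OF assms] by (simp add: distributed_def)
qed

lemma mean_eq_beta_times_mean:
  assumes "\<And>x. measure F {x} \<noteq> 1" "dirichlet_process \<Omega>1 1 F P" "dirichlet_process \<Omega>2 \<sigma> G Q"
    and "law \<Omega>2 B = beta_distr \<sigma> (1 - \<sigma>)" "prob_space.indep_var \<Omega>2 borel B borel (dirichlet_mean Q)"
  shows "law \<Omega>1 (dirichlet_mean P) = law \<Omega>2 (\<lambda>\<omega>. B \<omega> * dirichlet_mean Q \<omega>)"
  unfolding law_of_mean[OF assms(1,2)]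
  by (rule F.beta_times_dirichlet_mean_law[OF assms(1) \<sigma> law_X psi_F assms(3,4,5), symmetric])

end

section \<open>The densities of the means\<close>
lemma distributed_cong_AE:
  assumes "distributed \<Omega> N R f" "AE x in N. f x = g x" "g \<in> borel_measurable N"
  shows "distributed \<Omega> N R g"
  using assms density_cong[of f N g] by (auto simp: distributed_def)

theorem proposition3p1:
  fixes M :: "'a measure" and X Y :: "'a \<Rightarrow> real" and A :: "real \<Rightarrow> 'a \<Rightarrow> real"
    and \<sigma> c :: real
    and \<Omega>1 :: "'b measure" and \<Omega>2 :: "'c measure"
  assumes "prob_space M"
    and "X \<in> borel_measurable M"
    and "AE \<omega> in M. 0 \<le> X \<omega>"
    and "\<And>l. 0 < l \<Longrightarrow> integrable M (\<lambda>\<omega>. ln (1 + l * X \<omega>))"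
    and "\<And>c. 0 < c \<Longrightarrow> A c \<in> borel_measurable M"
    and "\<And>c. 0 < c \<Longrightarrow> law M (A c) = law M (\<lambda>\<omega>. c * X \<omega> / (c * X \<omega> + 1))"
    and "0 < \<sigma>" and "\<sigma> \<le> 1"
    and "Y \<in> borel_measurable M"
    and "law M Y = distr (measure_pmf (bernoulli_pmf \<sigma>)) borel of_bool"
    and "prob_space.indep_var M borel X borel Y"
    and "\<And>c. 0 < c \<Longrightarrow> prob_space.indep_var M borel (A c) borel Y"
    and "\<And>x. measure (law M (\<lambda>\<omega>. X \<omega> * Y \<omega>)) {x} \<noteq> 1"
    and "0 < c"
  shows
    "(\<forall>P Q B.
        dirichlet_process \<Omega>1 1 (law M (\<lambda>\<omega>. X \<omega> * Y \<omega>)) P \<and>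
        dirichlet_process \<Omega>2 \<sigma> (law M X) Q \<and>
        law \<Omega>2 B = beta_distr \<sigma> (1 - \<sigma>) \<and>
        prob_space.indep_var \<Omega>2 borel B borel (dirichlet_mean Q) \<longrightarrow>
        law \<Omega>1 (dirichlet_mean P) = law \<Omega>2 (\<lambda>\<omega>. B \<omega> * dirichlet_mean Q \<omega>)) \<and>
     (\<forall>P Q B.
        dirichlet_process \<Omega>1 1 (law M (\<lambda>\<omega>. A c \<omega> * Y \<omega>)) P \<and>
        dirichlet_process \<Omega>2 \<sigma> (law M (A c)) Q \<and>
        law \<Omega>2 B = beta_distr \<sigma> (1 - \<sigma>) \<and>
        prob_space.indep_var \<Omega>2 borel B borel (dirichlet_mean Q) \<longrightarrow>
        law \<Omega>1 (dirichlet_mean P) = law \<Omega>2 (\<lambda>\<omega>. B \<omega> * dirichlet_mean Q \<omega>)) \<and>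
     (\<forall>P. dirichlet_process \<Omega>1 1 (law M (\<lambda>\<omega>. A c \<omega> * Y \<omega>)) P \<longrightarrow>
        distributed \<Omega>1 lborel (dirichlet_mean P) (\<lambda>y. ennreal
          (if 0 < y \<and> y < 1 then
             exp (\<sigma> * psi (law M X) c) * y powr (\<sigma> - 1) / (pi * c powr \<sigma> * (1 - y) powr \<sigma>)
             * sin (pi * cdf (law M (\<lambda>\<omega>. X \<omega> * Y \<omega>)) (y / (c * (1 - y))))
             * exp (- \<sigma> * Phi (law M X) (y / (c * (1 - y))))
           else 0))) \<and>
     (\<forall>P. dirichlet_process \<Omega>1 1 (law M (\<lambda>\<omega>. X \<omega> * Y \<omega>)) P \<longrightarrow>
        distributed \<Omega>1 lborel (dirichlet_mean P) (\<lambda>x. ennreal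
          (if 0 < x then
             exp (- \<sigma> * psi (law M X) 1) * x powr (\<sigma> - 1) / (pi * (1 + x) powr \<sigma>)
             * sin (pi * cdf (law M (\<lambda>\<omega>. A 1 \<omega> * Y \<omega>)) (x / (1 + x)))
             * exp (- \<sigma> * Phi (law M (A 1)) (x / (1 + x)))
           else 0)))"
proof -
  interpret M: prob_space M by fact
  have X [measurable]: "X \<in> borel_measurable M" by fact
  have Y [measurable]: "Y \<in> borel_measurable M" by fact
  have A [measurable]: "A d \<in> borel_measurable M" if "0 < d" for d using assms(5) that .
  have law_X: "half_line_prob (law M X)"
  proof -
    interpret G: prob_space "law M X" by (rule M.prob_space_distr) simp
    show ?thesis
      using assms(3,4) by unfold_locales (auto simp: AE_distr_iff integrable_distr_eq)
  qed
  interpret X: bernoulli_thinning M X Y \<sigma>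
    by (intro bernoulli_thinning.intro bernoulli_thinning_axioms.intro) (fact assms(1) X Y assms(7,8,10,11) law_X)+
  have law_A: "law M (A d) = distr (law M X) borel (squash d)" if "0 < d" for d
  proof -
    have "distr (law M X) borel (squash d) = law M (squash d \<circ> X)" by (rule distr_distr) measurable
    also have "\<dots> = law M (A d)" unfolding assms(6)[OF that] by (simp only: comp_def squash_def)
    finally show ?thesis ..
  qed
  have thin_A: "bernoulli_thinning M (A d) Y \<sigma>" if d: "0 < d" for d
  proof (intro bernoulli_thinning.intro bernoulli_thinning_axioms.intro)
    show "half_line_prob (law M (A d))"
      unfolding law_A[OF d] by (rule X.G.half_line_prob_squash[OF d])
  qed (fact assms(1) A[OF d] Y assms(7,8,10) assms(12)[OF d])+
  let ?FX = "law M (\<lambda>\<omega>. X \<omega> * Y \<omega>)" and ?FA = "\<lambda>d. law M (\<lambda>\<omega>. A d \<omega> * Y \<omega>)"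
  have atom_A: "measure (law M (A d)) {squash d x} = measure (law M X) {x}" if d: "0 < d" and "0 \<le> x" for d x
    unfolding law_A[OF d] using that squash_eq_iff[OF d] by (intro X.G.measure_squash) auto
  have cdf_A: "cdf (?FA d) (squash d x) = cdf ?FX x" if d: "0 < d" and x: "0 \<le> x" for d x
  proof -
    interpret A: bernoulli_thinning M "A d" Y \<sigma> by (rule thin_A[OF d])
    have "cdf (law M (A d)) (squash d x) = cdf (law M X) x"
      unfolding law_A[OF d] cdf_def using squash_le_iff[OF d x] by (intro X.G.measure_squash) auto
    then show ?thesis using A.cdf_F[of "squash d x"] X.cdf_F[OF x] squash_bounds(1)[OF d x] by simp
  qed
  have no_unit_A: "measure (?FA d) {y} \<noteq> 1" if d: "0 < d" for d y
  proof -
    interpret A: bernoulli_thinning M "A d" Y \<sigma> by (rule thin_A[OF d])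
    show ?thesis
    proof (cases "0 \<le> y \<and> y < 1")
      case True
      define x where "x = y / (d * (1 - y))"
      have x: "0 \<le> x" "y = squash d x" using squash_inverse[OF d, of y] True by (auto simp: x_def)
      \<comment> \<open>the map fixes 0, where both thinned laws have their additional atom\<close>
      have "indicator {y} (0::real) = (indicator {x} 0 :: real)"
        using squash_eq_iff[OF d x(1), of 0] by (auto simp: x(2) indicator_def squash_def)
      then have "measure (?FA d) {y} = measure ?FX {x}"
        using atom_A[OF d x(1)] by (simp add: A.measure_F X.measure_F x(2))
      then show ?thesis using assms(13) by simp
    next
      case False
      then have "measure (law M (A d)) {y} = measure (law M X) {}"
        unfolding law_A[OF d] using squash_bounds[OF d] by (intro X.G.measure_squash) auto
      then have "measure (?FA d) {y} = 0" using False by (auto simp: A.measure_F indicator_def)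
      then show ?thesis by simp
    qed
  qed
  interpret A: bernoulli_thinning M "A c" Y \<sigma> by (rule thin_A[OF assms(14)])
  interpret A1: bernoulli_thinning M "A 1" Y \<sigma> by (rule thin_A) simp
  have c: "0 < c" by fact
  show ?thesis
  proof (intro conjI allI impI; (elim conjE)?)
    fix P :: "'b \<Rightarrow> real measure" and Q :: "'c \<Rightarrow> real measure" and B
    assume "dirichlet_process \<Omega>1 1 ?FX P" "dirichlet_process \<Omega>2 \<sigma> (law M X) Q"
      "law \<Omega>2 B = beta_distr \<sigma> (1 - \<sigma>)" "prob_space.indep_var \<Omega>2 borel B borel (dirichlet_mean Q)"
    from X.mean_eq_beta_times_mean[OF assms(13) this]
    show "law \<Omega>1 (dirichlet_mean P) = law \<Omega>2 (\<lambda>\<omega>. B \<omega> * dirichlet_mean Q \<omega>)" .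
  next
    fix P :: "'b \<Rightarrow> real measure" and Q :: "'c \<Rightarrow> real measure" and B
    assume "dirichlet_process \<Omega>1 1 (?FA c) P" "dirichlet_process \<Omega>2 \<sigma> (law M (A c)) Q"
      "law \<Omega>2 B = beta_distr \<sigma> (1 - \<sigma>)" "prob_space.indep_var \<Omega>2 borel B borel (dirichlet_mean Q)"
    from A.mean_eq_beta_times_mean[OF no_unit_A[OF c] this]
    show "law \<Omega>1 (dirichlet_mean P) = law \<Omega>2 (\<lambda>\<omega>. B \<omega> * dirichlet_mean Q \<omega>)" .
  next
    fix P :: "'b \<Rightarrow> real measure"
    assume dp: "dirichlet_process \<Omega>1 1 (?FA c) P"
    let ?\<xi> = "\<lambda>y. if 0 < y \<and> y < 1 then
             exp (\<sigma> * psi (law M X) c) * y powr (\<sigma> - 1) / (pi * c powr \<sigma> * (1 - y) powr \<sigma>)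
             * sin (pi * cdf ?FX (y / (c * (1 - y))))
             * exp (- \<sigma> * Phi (law M X) (y / (c * (1 - y))))
           else 0"
    show "distributed \<Omega>1 lborel (dirichlet_mean P) (\<lambda>y. ennreal (?\<xi> y))"
    proof (rule distributed_cong_AE[OF A.F.dirichlet_mean_1_law[OF no_unit_A[OF c] dp]])
      show "AE y in lborel. ennreal (mean_density (?FA c) y) = ennreal (?\<xi> y)"
        using A.G.AE_log_potential_integrable A.G.AE_lborel_no_atom AE_lborel_singleton[of 0]
      proof eventually_elim
        case (elim y)
        consider "y < 0" | "1 \<le> y" | "0 < y" "y < 1" using elim(3) by linarith
        then have "mean_density (?FA c) y = ?\<xi> y"
        proof cases
          case 1
          then show ?thesis by (simp add: A.mean_density_F_neg)
        next
          case 2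
          \<comment> \<open>the law of \<open>A c\<close> lives below 1, so the sine vanishes beyond 1\<close>
          have "measure (law M (A c)) {..y} = measure (law M X) UNIV"
            unfolding law_A[OF c]
          proof (rule X.G.measure_squash)
            show "squash c t \<in> {..y} \<longleftrightarrow> t \<in> UNIV" if "0 \<le> t" for t
              using squash_bounds(2)[OF c that] 2 by simp
          qed auto
          then have "cdf (law M (A c)) y = 1" using X.G.prob_space by (simp add: cdf_def)
          then have "cdf (?FA c) y = 1" using A.cdf_F[of y] 2 by simp
          then show ?thesis using 2 by (simp add: mean_density_def)
        next
          case 3
          define x where "x = y / (c * (1 - y))"
          have x: "0 \<le> x" "squash c x = y" using squash_inverse[OF c, of y] 3 by (auto simp: x_def)
          \<comment> \<open>integrability and the absence of an atom are pulled back from \<open>y\<close> to \<open>x\<close>\<close>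
          have atom: "measure (law M X) {x} = 0" using atom_A[OF c x(1)] elim(2) x(2) by simp
          note Phi = X.G.Phi_squash[OF c x(1) atom, folded law_A[OF c], unfolded x(2)]
          have "exp (- \<sigma> * Phi (law M (A c)) y)
              = exp (\<sigma> * psi (law M X) c) * exp (- \<sigma> * Phi (law M X) x) / (c powr \<sigma> * (1 - y) powr \<sigma>)"
          proof -
            have Phi_y: "Phi (law M (A c)) y = Phi (law M X) x + ln c + ln (1 - y) - psi (law M X) c"
              using Phi elim(1) by simp
            have "- \<sigma> * Phi (law M (A c)) y
                = \<sigma> * psi (law M X) c + - \<sigma> * Phi (law M X) x - (\<sigma> * ln c + \<sigma> * ln (1 - y))"
              unfolding Phi_y by (simp add: algebra_simps)
            then show ?thesis using c 3 by (simp add: powr_def exp_add exp_diff exp_minus divide_inverse)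
          qed
          then show ?thesis
            using 3 cdf_A[OF c x(1)] x(2) A.mean_density_F[OF 3(1) elim(1)] unfolding x_def[symmetric] by (simp add: mult_ac)
        qed
        then show ?case by simp
      qed
    qed measurable
  next
    fix P :: "'b \<Rightarrow> real measure"
    assume dp: "dirichlet_process \<Omega>1 1 ?FX P"
    let ?\<xi> = "\<lambda>x. if 0 < x then
             exp (- \<sigma> * psi (law M X) 1) * x powr (\<sigma> - 1) / (pi * (1 + x) powr \<sigma>)
             * sin (pi * cdf (?FA 1) (x / (1 + x)))
             * exp (- \<sigma> * Phi (law M (A 1)) (x / (1 + x)))
           else 0"
    show "distributed \<Omega>1 lborel (dirichlet_mean P) (\<lambda>x. ennreal (?\<xi> x))"
    proof (rule distributed_cong_AE[OF X.F.dirichlet_mean_1_law[OF assms(13) dp]])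
      show "AE x in lborel. ennreal (mean_density ?FX x) = ennreal (?\<xi> x)"
        using X.G.AE_log_potential_integrable X.G.AE_lborel_no_atom AE_lborel_singleton[of 0]
      proof eventually_elim
        case (elim x)
        consider "x < 0" | "0 < x" using elim(3) by linarith
        then have "mean_density ?FX x = ?\<xi> x"
        proof cases
          case 1
          then show ?thesis by (simp add: X.mean_density_F_neg)
        next
          case 2
          have y: "squash 1 x = x / (1 + x)" by (simp add: squash_def add.commute)
          have y': "1 - x / (1 + x) = 1 / (1 + x)" using 2 by (simp add: field_simps)
          have Phi_y: "Phi (law M (A 1)) (x / (1 + x)) = Phi (law M X) x - ln (1 + x) - psi (law M X) 1"
            using X.G.Phi_squash(2)[OF zero_less_one _ elim(2) elim(1), folded law_A[OF zero_less_one]] 2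
            by (simp add: y y' ln_div)
          have "exp (- \<sigma> * Phi (law M (A 1)) (x / (1 + x)))
              = exp (\<sigma> * psi (law M X) 1) * exp (- \<sigma> * Phi (law M X) x) * (1 + x) powr \<sigma>"
            unfolding Phi_y using 2 by (simp add: powr_def algebra_simps flip: exp_add)
          then show ?thesis
            using 2 cdf_A[OF zero_less_one, of x] y X.mean_density_F[OF 2 elim(1)]
            by (simp add: exp_minus field_simps)
        qed
        then show ?case by simp
      qed
    qed measurable
  qed
qed

end
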